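(* Let $\Gamma$ be a suitable class of subsets of Polish spaces. If every $\Gamma$-subset of $\mathbb{R}^\omega$ is determined, then for every analytic Gowers space $\mathcal{G} = (P, X, \leqslant, \leqslant^*, \vartriangleleft)$, every $\Gamma$-subset of $X^\omega$ is adversarially Ramsey.
   Context: For a set $X$, $\mathrm{Seq}(X) = X^{<\omega}\setminus\{\varnothing\}$; $s^\frown x$ is the sequence $s$ extended by the single term $x$. A \emph{Gowers space} is a quintuple $\mathcal{G} = (P, X, \leqslant, \leqslant^*, \vartriangleleft)$, where $P$ is a nonempty set, $X$ is an at most countable nonempty set, $\leqslant$ and $\leqslant^*$ are quasiorders on $P$, and $\vartriangleleft\ \subseteq \mathrm{Seq}(X)\times P$, such that: (1) for all $p,q\in P$, if $p\leqslant q$ then $p\leqslant^* q$; (2) for all $p,q\in P$, if $p\leqslant^* q$ then there is $r\in P$ with $r\leqslant p$, $r\leqslant q$ and $p\leqslant^* r$; (3) for every $\leqslant$-decreasing sequence $(p_i)_{i\in\omega}$ in $P$ there is $p^*\in P$ with $p^*\leqslant^* p_i$ for all $i$; (4) for every $p\in P$ and $s\in X^{<\omega}$ there is $x\in X$ with $s^\frown x\vartriangleleft p$; (5) for every $s\in\mathrm{Seq}(X)$ and $p,q\in P$, if $s\vartriangleleft p$ and $p\leqslant q$ then $s\vartriangleleft q$. Write $p\lessapprox q$ when $p\leqslant q$ and $q\leqslant^* p$. $X$ carries the discrete topology and $X^\omega$ the product topology. The Gowers space $\mathcal{G}$ is \emph{analytic} if $P$ is an analytic subset of a Polish space and the relations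 $\leqslant$ and $\vartriangleleft$ are Borel subsets of $P^2$ and of $\mathrm{Seq}(X)\times P$ respectively. A class $\Gamma$ of subsets of Polish spaces is \emph{suitable} if it contains the class of Borel sets and is stable under finite unions, finite intersections and Borel inverse images. $\mathbb{R}$ has its usual Polish topology and $\mathbb{R}^\omega$ the product topology; a subset of $\mathbb{R}^\omega$ is determined if the corresponding Gale--Stewart game, in which two players alternately choose elements of $\mathbb{R}$, is determined. \emph{Adversarial Gowers' games.} For $p\in P$, in the game $A_p$: II plays $p_0$; I plays $(x_0,q_0)$; II plays $(y_0,p_1)$; I plays $(x_1,q_1)$; II plays $(y_1,p_2)$; etc., with $x_i,y_i\in X$ and $p_i,q_i\in P$. Rules for I: for all $i$, $(x_0,y_0,\ldots,x_{i-1},y_{i-1},x_i)\vartriangleleft p_i$ and $q_i\lessapprox p$. Rules for II: for all $i$, $(x_0,y_0,\ldots,x_i,y_i)\vartriangleleft q_i$ and $p_i\leqslant p$. The outcome is $(x_0,y_0,x_1,y_1,\ldots)\in X^\omega$. The game $B_p$ is defined in the same way except that one requires $p_i\lessapprox p$, and only $q_i\leqslant p$. A player \emph{has a strategy to reach} a set $\mathcal{Y}$ in a game if she/he has a winning strategy in the game with those rules and whose winning condition for that player is that the outcome belongs to $\mathcal{Y}$. A set $\mathcal{X}\subseteq X^\omega$ is \emph{adversarially Ramsey} if for every $p\in P$ there is $q\leqslant p$ such that either I has a strategy to reach $\mathcal{X}$ in $A_q$, or II has a strategy to reach $\mathcal{X}^c$ in $B_q$. *)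

theory Defs
  imports "HOL-Analysis.Analysis"
begin

section \<open>Polish spaces, Borel sets, analytic sets\<close>

definition polish_topology :: "'a topology \<Rightarrow> bool" where
  "polish_topology T \<longleftrightarrow> completely_metrizable_space T \<and> separable_space T"

definition borel_alg :: "'a topology \<Rightarrow> 'a measure" where
  "borel_alg T = sigma (topspace T) {U. openin T U}"

text \<open>
  HOL cannot quantify over types, so ``all Polish spaces'' is rendered as all Polish topologies
  (with arbitrary carrier) on one type of the cardinality of the continuum.  A Polish space has at
  most that many points, so each one is homeomorphic to one of these.
\<close>

type_synonym univ = "nat \<Rightarrow> real"

definition analytic_in :: "'a topology \<Rightarrow> 'a set \<Rightarrow> bool" where
  "analytic_in T A \<longleftrightarrow>
     (\<exists>(S :: univ topology) f. polish_topology S \<and> continuous_map S T f \<and> f ` topspace S = A)"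

text \<open>A class \<open>\<Gamma>\<close> assigns to each Polish space \<open>T\<close> the family \<open>\<Gamma> T\<close> of its members among the
  subsets of \<open>T\<close>; the values of \<open>\<Gamma>\<close> at topologies that are not Polish are irrelevant.\<close>

definition suitable :: "(univ topology \<Rightarrow> univ set set) \<Rightarrow> bool" where
  "suitable \<Gamma> \<longleftrightarrow>
     (\<forall>T. polish_topology T \<longrightarrow>
        \<Gamma> T \<subseteq> Pow (topspace T) \<and>
        sets (borel_alg T) \<subseteq> \<Gamma> T \<and>
        (\<forall>A\<in>\<Gamma> T. \<forall>B\<in>\<Gamma> T. A \<union> B \<in> \<Gamma> T \<and> A \<inter> B \<in> \<Gamma> T)) \<and>
     (\<forall>S T f. polish_topology S \<longrightarrow> polish_topology T \<longrightarrow> f \<in> borel_alg S \<rightarrow>\<^sub>M borel_alg T \<longrightarrow>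
        (\<forall>A\<in>\<Gamma> T. f -` A \<inter> topspace S \<in> \<Gamma> S))"

text \<open>
  Membership in \<open>\<Gamma>\<close> for a subset of a Polish space \<open>T\<close> on any type, by transport along a
  homeomorphism.  Closure under Borel inverse images makes this independent of the
  homeomorphism; on the type \<^typ>\<open>univ\<close> itself it is plain membership, as shown below.
\<close>

definition class_subset ::
  "(univ topology \<Rightarrow> univ set set) \<Rightarrow> 'a topology \<Rightarrow> 'a set \<Rightarrow> bool" where
  "class_subset \<Gamma> T A \<longleftrightarrow> A \<subseteq> topspace T \<and>
     (\<exists>U h. polish_topology U \<and> homeomorphic_map T U h \<and> h ` A \<in> \<Gamma> U)"

lemma space_borel_alg [simp]: "space (borel_alg T) = topspace T"
  by (simp add: borel_alg_def space_measure_of_conv)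

lemma continuous_map_borel_alg:
  assumes "continuous_map S T f"
  shows "f \<in> borel_alg S \<rightarrow>\<^sub>M borel_alg T"
  unfolding borel_alg_def[of T]
proof (rule measurable_measure_of)
  show "{U. openin T U} \<subseteq> Pow (topspace T)"
    using openin_subset by blast
  show "f \<in> space (borel_alg S) \<rightarrow> topspace T"
    using assms by (simp add: continuous_map_def)
  show "f -` U \<inter> space (borel_alg S) \<in> sets (borel_alg S)" if "U \<in> {U. openin T U}" for U
  proof -
    have "f -` U \<inter> topspace S = {x \<in> topspace S. f x \<in> U}" by blast
    then have "openin S (f -` U \<inter> topspace S)"
      using assms that by (simp add: continuous_map_def)
    moreover have "{U. openin S U} \<subseteq> Pow (topspace S)"
      using openin_subset by blast
    ultimately show ?thesis by (simp add: borel_alg_def)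
  qed
qed

lemma suitableD:
  assumes "suitable \<Gamma>"
  shows suitable_subset: "\<And>T A. polish_topology T \<Longrightarrow> A \<in> \<Gamma> T \<Longrightarrow> A \<subseteq> topspace T"
    and suitable_vimage: "\<And>S T f A. polish_topology S \<Longrightarrow> polish_topology T \<Longrightarrow>
      f \<in> borel_alg S \<rightarrow>\<^sub>M borel_alg T \<Longrightarrow> A \<in> \<Gamma> T \<Longrightarrow> f -` A \<inter> topspace S \<in> \<Gamma> S"
  using assms unfolding suitable_def by (simp_all only: Pow_iff subset_iff) simp_all

lemma class_subset_univ_iff:
  fixes T :: "univ topology"
  assumes \<Gamma>: "suitable \<Gamma>" and T: "polish_topology T"
  shows "class_subset \<Gamma> T A \<longleftrightarrow> A \<in> \<Gamma> T"
proof
  assume "class_subset \<Gamma> T A"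
  then obtain U h where A: "A \<subseteq> topspace T" and U: "polish_topology U"
    and h: "homeomorphic_map T U h" and hA: "h ` A \<in> \<Gamma> U"
    unfolding class_subset_def by (elim conjE exE)
  have "h \<in> borel_alg T \<rightarrow>\<^sub>M borel_alg U"
    by (rule continuous_map_borel_alg[OF homeomorphic_imp_continuous_map[OF h]])
  from suitable_vimage[OF \<Gamma> T U this hA]
  have "h -` (h ` A) \<inter> topspace T \<in> \<Gamma> T" .
  moreover have "h -` (h ` A) \<inter> topspace T = A"
  proof
    show "h -` (h ` A) \<inter> topspace T \<subseteq> A"
      using A homeomorphic_imp_injective_map[OF h] by (auto dest: inj_onD)
    show "A \<subseteq> h -` (h ` A) \<inter> topspace T"
      using A by blast
  qed
  ultimately show "A \<in> \<Gamma> T" by (simp only:)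
next
  assume A: "A \<in> \<Gamma> T"
  have "homeomorphic_map T T id"
    by (simp add: homeomorphic_map_id)
  moreover have "id ` A \<in> \<Gamma> T"
    using A by simp
  ultimately show "class_subset \<Gamma> T A"
    unfolding class_subset_def using suitable_subset[OF \<Gamma> T A] T by (intro conjI exI)
qed


section \<open>Gale--Stewart games on the reals\<close>

abbreviation real_omega :: "(nat \<Rightarrow> real) topology" where
  "real_omega \<equiv> product_topology (\<lambda>_. euclideanreal) UNIV"

text \<open>The first player makes the moves with even index and wants the run to be in \<open>A\<close>.\<close>

definition determined :: "(nat \<Rightarrow> real) set \<Rightarrow> bool" where
  "determined A \<longleftrightarrow>
     (\<exists>\<sigma> :: real list \<Rightarrow> real. \<forall>r. (\<forall>n. even n \<longrightarrow> r n = \<sigma> (map r [0..<n])) \<longrightarrow> r \<in> A) \<or>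
     (\<exists>\<tau> :: real list \<Rightarrow> real. \<forall>r. (\<forall>n. odd n \<longrightarrow> r n = \<tau> (map r [0..<n])) \<longrightarrow> r \<notin> A)"


section \<open>Gowers spaces\<close>

record ('p, 'x) gowers =
  Pset :: "'p set"
  Xset :: "'x set"
  le :: "('p \<times> 'p) set"
  le_star :: "('p \<times> 'p) set"
  tri :: "('x list \<times> 'p) set"

definition Seq :: "'x set \<Rightarrow> 'x list set" where
  "Seq X = lists X - {[]}"

definition gowers_space :: "('p, 'x) gowers \<Rightarrow> bool" where
  "gowers_space G \<longleftrightarrow>
     Pset G \<noteq> {} \<and> countable (Xset G) \<and> Xset G \<noteq> {} \<and>
     preorder_on (Pset G) (le G) \<and> preorder_on (Pset G) (le_star G) \<and>
     tri G \<subseteq> Seq (Xset G) \<times> Pset G \<and>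
     le G \<subseteq> le_star G \<and>
     (\<forall>p q. (p, q) \<in> le_star G \<longrightarrow>
        (\<exists>r\<in>Pset G. (r, p) \<in> le G \<and> (r, q) \<in> le G \<and> (p, r) \<in> le_star G)) \<and>
     (\<forall>p :: nat \<Rightarrow> 'p. (\<forall>i. p i \<in> Pset G) \<longrightarrow> (\<forall>i. (p (Suc i), p i) \<in> le G) \<longrightarrow>
        (\<exists>p'\<in>Pset G. \<forall>i. (p', p i) \<in> le_star G)) \<and>
     (\<forall>p\<in>Pset G. \<forall>s\<in>lists (Xset G). \<exists>x\<in>Xset G. (s @ [x], p) \<in> tri G) \<and>
     (\<forall>s\<in>Seq (Xset G). \<forall>p\<in>Pset G. \<forall>q\<in>Pset G.
        (s, p) \<in> tri G \<longrightarrow> (p, q) \<in> le G \<longrightarrow> (s, q) \<in> tri G)"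

definition lessapprox :: "('p, 'x) gowers \<Rightarrow> 'p \<Rightarrow> 'p \<Rightarrow> bool" where
  "lessapprox G p q \<longleftrightarrow> (p, q) \<in> le G \<and> (q, p) \<in> le_star G"

definition analytic_gowers_space :: "('p, 'x) gowers \<Rightarrow> bool" where
  "analytic_gowers_space G \<longleftrightarrow> gowers_space G \<and>
     (\<exists>T. polish_topology T \<and> Pset G \<subseteq> topspace T \<and> analytic_in T (Pset G) \<and>
        le G \<in> sets (borel_alg
          (prod_topology (subtopology T (Pset G)) (subtopology T (Pset G)))) \<and>
        tri G \<in> sets (borel_alg
          (prod_topology (discrete_topology (Seq (Xset G))) (subtopology T (Pset G)))))"

abbreviation X_omega :: "('p, 'x) gowers \<Rightarrow> (nat \<Rightarrow> 'x) topology" where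
  "X_omega G \<equiv> product_topology (\<lambda>_. discrete_topology (Xset G)) UNIV"


section \<open>Adversarial Gowers' games\<close>

definition outcome :: "(nat \<Rightarrow> 'x) \<Rightarrow> (nat \<Rightarrow> 'x) \<Rightarrow> nat \<Rightarrow> 'x" where
  "outcome x y n = (if even n then x (n div 2) else y (n div 2))"

text \<open>
  A run consists of \<open>p\<close>, \<open>x\<close>, \<open>q\<close>, \<open>y\<close>: II plays \<open>p 0\<close>, and then, for each \<open>i\<close>, I plays
  \<open>(x i, q i)\<close> and II plays \<open>(y i, p (Suc i))\<close>.  The predicates \<open>C\<close> and \<open>D\<close> are the
  constraints on the subspaces \<open>q i\<close> and \<open>p i\<close>; they are what distinguishes the two games.
  \<open>legal_II \<dots> i\<close> concerns the move of II that contains \<open>p i\<close>, so it also covers the point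
  \<open>y (i - 1)\<close> if \<open>i > 0\<close>.
\<close>

definition legal_I :: "('p, 'x) gowers \<Rightarrow> ('p \<Rightarrow> bool) \<Rightarrow>
    (nat \<Rightarrow> 'p) \<Rightarrow> (nat \<Rightarrow> 'x) \<Rightarrow> (nat \<Rightarrow> 'p) \<Rightarrow> (nat \<Rightarrow> 'x) \<Rightarrow> nat \<Rightarrow> bool" where
  "legal_I G C p x q y i \<longleftrightarrow>
     x i \<in> Xset G \<and> q i \<in> Pset G \<and>
     (map (outcome x y) [0..<2 * i + 1], p i) \<in> tri G \<and> C (q i)"

definition legal_II :: "('p, 'x) gowers \<Rightarrow> ('p \<Rightarrow> bool) \<Rightarrow>
    (nat \<Rightarrow> 'p) \<Rightarrow> (nat \<Rightarrow> 'x) \<Rightarrow> (nat \<Rightarrow> 'p) \<Rightarrow> (nat \<Rightarrow> 'x) \<Rightarrow> nat \<Rightarrow> bool" where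
  "legal_II G D p x q y i \<longleftrightarrow>
     p i \<in> Pset G \<and> D (p i) \<and>
     (i > 0 \<longrightarrow> y (i - 1) \<in> Xset G \<and>
        (map (outcome x y) [0..<2 * i], q (i - 1)) \<in> tri G)"

text \<open>The first player to break a rule loses.  In \<open>wins_I\<close> and \<open>wins_II\<close>, the set \<open>Y\<close> is the
  set of outcomes that are good for the player in question.\<close>

definition wins_I where
  "wins_I G C D Y p x q y \<longleftrightarrow>
     (\<exists>i. \<not> legal_II G D p x q y i \<and> (\<forall>j<i. legal_I G C p x q y j \<and> legal_II G D p x q y j)) \<or>
     ((\<forall>i. legal_I G C p x q y i \<and> legal_II G D p x q y i) \<and> outcome x y \<in> Y)"

definition wins_II where
  "wins_II G C D Y p x q y \<longleftrightarrow>
     (\<exists>i. \<not> legal_I G C p x q y i \<and> (\<forall>j<i. legal_I G C p x q y j) \<and>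
        (\<forall>j\<le>i. legal_II G D p x q y j)) \<or>
     ((\<forall>i. legal_I G C p x q y i \<and> legal_II G D p x q y i) \<and> outcome x y \<in> Y)"

text \<open>A strategy maps the list of the opponent's previous moves to the next move; for I the
  opening move \<open>p 0\<close> is a separate argument, and for II that move is \<open>\<tau>0\<close>.\<close>

definition I_can_reach ::
  "('p, 'x) gowers \<Rightarrow> ('p \<Rightarrow> bool) \<Rightarrow> ('p \<Rightarrow> bool) \<Rightarrow> (nat \<Rightarrow> 'x) set \<Rightarrow> bool" where
  "I_can_reach G C D Y \<longleftrightarrow>
     (\<exists>\<sigma> :: 'p \<Rightarrow> ('x \<times> 'p) list \<Rightarrow> 'x \<times> 'p. \<forall>p x q y.
        (\<forall>i. (x i, q i) = \<sigma> (p 0) (map (\<lambda>j. (y j, p (Suc j))) [0..<i])) \<longrightarrow>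
        wins_I G C D Y p x q y)"

definition II_can_reach ::
  "('p, 'x) gowers \<Rightarrow> ('p \<Rightarrow> bool) \<Rightarrow> ('p \<Rightarrow> bool) \<Rightarrow> (nat \<Rightarrow> 'x) set \<Rightarrow> bool" where
  "II_can_reach G C D Y \<longleftrightarrow>
     (\<exists>(\<tau>0 :: 'p) (\<tau> :: ('x \<times> 'p) list \<Rightarrow> 'x \<times> 'p). \<forall>p x q y.
        p 0 = \<tau>0 \<and> (\<forall>i. (y i, p (Suc i)) = \<tau> (map (\<lambda>j. (x j, q j)) [0..<Suc i])) \<longrightarrow>
        wins_II G C D Y p x q y)"

definition I_reaches_in_A where
  "I_reaches_in_A G p Y \<longleftrightarrow> I_can_reach G (\<lambda>q. lessapprox G q p) (\<lambda>p'. (p', p) \<in> le G) Y"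

definition II_reaches_in_B where
  "II_reaches_in_B G p Y \<longleftrightarrow> II_can_reach G (\<lambda>q. (q, p) \<in> le G) (\<lambda>p'. lessapprox G p' p) Y"

definition adversarially_Ramsey :: "('p, 'x) gowers \<Rightarrow> (nat \<Rightarrow> 'x) set \<Rightarrow> bool" where
  "adversarially_Ramsey G \<X> \<longleftrightarrow>
     (\<forall>p\<in>Pset G. \<exists>q\<in>Pset G. (q, p) \<in> le G \<and>
        (I_reaches_in_A G q \<X> \<or> II_reaches_in_B G q (topspace (X_omega G) - \<X>)))"

end

theory Submission
  imports Defs
begin

text \<open>
  The theorem transfers determinacy from an auxiliary game that is played with real moves to the
  two adversarial games.  The auxiliary game is the game of Kastanas: it has the shape of \<open>A\<^sub>p\<close>
  and \<open>B\<^sub>p\<close>, but each subspace that is played has to lie below the subspace played just before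
  it.  In \<open>A\<^sub>p\<close> and \<open>B\<^sub>p\<close> the player who is meant to win may hardly shrink \<open>p\<close>, whereas in the
  game of Kastanas both players shrink subspaces freely, so its rules treat them alike.

  Two facts carry the proof.  The first is that the game of Kastanas is determined.  Since \<open>P\<close> is
  analytic and \<open>X\<close> is countable, there is a Borel map from the reals onto \<open>X \<times> P\<close>
  (\<open>analytic_gowers_space_coding\<close>), so that a move can be coded by a real number.  Because \<open>\<le>\<close> and
  \<open>\<lhd>\<close> are Borel, the rules become Borel conditions on the sequence of codes, and the set of runs
  won by I is obtained from Borel sets and a Borel inverse image of \<open>\<X>\<close>, by one union and one
  intersection (\<open>payoff_in_class\<close>).  Complements are not at hand in a suitable class, so it is I,
  whose goal is \<open>\<X>\<close> itself, who must be the first player; an idle opening move of I achieves that.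

  The second fact is that the winner of the game of Kastanas can win, below some \<open>q \<le> p\<close>, while
  playing only subspaces \<open>\<lessapprox> q\<close> (\<open>I_wins_imp_reaches_in_A\<close> and \<open>II_wins_imp_reaches_in_B\<close>).  The
  reason is a fusion argument (\<open>gowers_fusion\<close>).  Positions reached under the winning strategy are
  to be simulated, but the opponent has too many subspaces to choose from.  Only the points matter
  for the outcome, and there are countably many of them: for each simulated position and each pair
  consisting of a point of the opponent and the point of the reply, fix one subspace of the opponent
  that leads to this reply, if some subspace that is still large enough does.  Diagonalising over
  these countably many choices gives \<open>q\<close> with \<open>q \<le>* r\<close> for each subspace \<open>r\<close> in force at a
  simulated position.  If the opponent now plays \<open>(x, r)\<close> with \<open>r \<le> q\<close>, then some \<open>r' \<le> r\<close> lies
  below the subspace in force; the reply of the strategy to \<open>(x, r')\<close> has a point that is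
  legal for \<open>r'\<close>, thus for \<open>r\<close>, and the same point is the reply at some simulated position.  There
  the simulation goes on, with a subspace \<open>\<lessapprox> q\<close> below the one now in force, which makes each
  answer of the opponent legal in the simulated run.
\<close>

section \<open>Fusion in Gowers spaces\<close>

lemma gowers_spaceD:
  assumes "gowers_space G"
  shows gowers_le_carrier: "\<And>p q. (p, q) \<in> le G \<Longrightarrow> p \<in> Pset G \<and> q \<in> Pset G"
    and gowers_le_refl: "\<And>p. p \<in> Pset G \<Longrightarrow> (p, p) \<in> le G"
    and gowers_le_trans: "\<And>p q r. (p, q) \<in> le G \<Longrightarrow> (q, r) \<in> le G \<Longrightarrow> (p, r) \<in> le G"
    and gowers_le_star_trans:
      "\<And>p q r. (p, q) \<in> le_star G \<Longrightarrow> (q, r) \<in> le_star G \<Longrightarrow> (p, r) \<in> le_star G"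
    and gowers_le_imp_le_star: "\<And>p q. (p, q) \<in> le G \<Longrightarrow> (p, q) \<in> le_star G"
    and gowers_refine: "\<And>p q. (p, q) \<in> le_star G \<Longrightarrow>
      \<exists>r. (r, p) \<in> le G \<and> (r, q) \<in> le G \<and> (p, r) \<in> le_star G"
    and gowers_diagonal: "\<And>f. (\<And>i. f i \<in> Pset G) \<Longrightarrow> (\<And>i::nat. (f (Suc i), f i) \<in> le G) \<Longrightarrow>
      \<exists>r. \<forall>i. (r, f i) \<in> le_star G"
    and gowers_tri_mono: "\<And>s p q. (s, p) \<in> tri G \<Longrightarrow> (p, q) \<in> le G \<Longrightarrow> (s, q) \<in> tri G"
    and gowers_X: "countable (Xset G)" "Xset G \<noteq> {}"
proof -
  have pre: "preorder_on (Pset G) (le G)" "preorder_on (Pset G) (le_star G)" and sub: "le G \<subseteq> le_star G"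
    and tri: "tri G \<subseteq> Seq (Xset G) \<times> Pset G"
    and refine: "\<forall>p q. (p, q) \<in> le_star G \<longrightarrow>
        (\<exists>r\<in>Pset G. (r, p) \<in> le G \<and> (r, q) \<in> le G \<and> (p, r) \<in> le_star G)"
    and diag: "\<forall>p :: nat \<Rightarrow> 'a. (\<forall>i. p i \<in> Pset G) \<longrightarrow> (\<forall>i. (p (Suc i), p i) \<in> le G) \<longrightarrow>
        (\<exists>p'\<in>Pset G. \<forall>i. (p', p i) \<in> le_star G)"
    and mono: "\<forall>s\<in>Seq (Xset G). \<forall>p\<in>Pset G. \<forall>q\<in>Pset G.
        (s, p) \<in> tri G \<longrightarrow> (p, q) \<in> le G \<longrightarrow> (s, q) \<in> tri G"
    and X: "countable (Xset G)" "Xset G \<noteq> {}"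
    using assms unfolding gowers_space_def by - (elim conjE, assumption)+
  show 1: "p \<in> Pset G \<and> q \<in> Pset G" if "(p, q) \<in> le G" for p q
    using pre(1) that unfolding preorder_on_def by auto
  show "(p, p) \<in> le G" if "p \<in> Pset G" for p
    using pre(1) that unfolding preorder_on_def refl_on_def by simp
  show "(p, r) \<in> le G" if "(p, q) \<in> le G" "(q, r) \<in> le G" for p q r
    using pre(1) that unfolding preorder_on_def by (elim conjE transE)
  show "(p, r) \<in> le_star G" if "(p, q) \<in> le_star G" "(q, r) \<in> le_star G" for p q r
    using pre(2) that unfolding preorder_on_def by (elim conjE transE)
  show "(p, q) \<in> le_star G" if "(p, q) \<in> le G" for p q
    using sub that by (rule subsetD)
  show "\<exists>r. (r, p) \<in> le G \<and> (r, q) \<in> le G \<and> (p, r) \<in> le_star G" if "(p, q) \<in> le_star G" for p q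
    using refine[rule_format, OF that] by (elim bexE) (rule exI)
  show "\<exists>r. \<forall>i. (r, f i) \<in> le_star G"
    if "\<And>i. f i \<in> Pset G" "\<And>i::nat. (f (Suc i), f i) \<in> le G" for f
    using diag[rule_format, of f, OF that] by (elim bexE) (rule exI)
  show "(s, q) \<in> tri G" if "(s, p) \<in> tri G" "(p, q) \<in> le G" for s p q
    using mono[rule_format, OF _ _ _ that] 1[OF that(2)] subsetD[OF tri that(1)] by simp
  show "countable (Xset G)" "Xset G \<noteq> {}"
    by (rule X)+
qed

text \<open>
  Diagonalisation over a countable tree of choices that is itself built along the way.  States \<open>h\<close>
  stand for positions of a game in which \<open>cur h\<close> is the subspace in force; a transition into \<open>h'\<close> has
  a label, and is brought about by the subspace \<open>ent h'\<close> of the opponent.  The point of \<open>W\<close> is that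
  it contains only countably many of the possible states, so that one subspace \<open>q\<close> fits all of them,
  and yet represents every label that can be obtained by some subspace below \<open>q\<close>.

  States are selected one at a time along a decreasing sequence of subspaces \<open>r n\<close>: stage
  \<open>prod_encode (i, l)\<close> treats label \<open>l\<close> at the \<open>i\<close>-th selected state, which already exists because \<open>i\<close>
  is at most the code.  The question asked at stage \<open>n\<close> is whether some transition has
  \<open>ent h' \<le>* r n\<close>; asking for \<open>\<le>\<close> would not do, since a subspace below \<open>q\<close> is only known to be
  \<open>\<le>* r n\<close>.  If there is such a transition, then \<open>cur h' \<le>* r n\<close>, and the two have a common
  refinement that serves as \<open>r (n + 1)\<close>.
\<close>

lemma gowers_fusion:
  fixes cur ent :: "'h \<Rightarrow> 'p" and ext :: "nat \<Rightarrow> 'h \<Rightarrow> 'h \<Rightarrow> bool"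
  assumes G: "gowers_space G" and h0: "h0 \<in> S" "cur h0 \<in> Pset G"
    and step: "\<forall>h\<in>S. \<forall>l h'. ext l h h' \<longrightarrow> h' \<in> S \<and> (cur h', ent h') \<in> le G"
  shows "\<exists>q W. (q, cur h0) \<in> le G \<and> h0 \<in> W \<and> W \<subseteq> S \<and>
    (\<forall>h\<in>W. (q, cur h) \<in> le_star G) \<and>
    (\<forall>h\<in>W. \<forall>l h'. ext l h h' \<longrightarrow> (ent h', q) \<in> le_star G \<longrightarrow> (\<exists>h''\<in>W. ext l h h''))"
proof -
  note ext = step[rule_format]
  \<comment> \<open>A stage is a pair of the current subspace and the list of the states selected so far.\<close>
  define Inv where "Inv n s \<longleftrightarrow> length (snd s) = Suc n \<and> snd s ! 0 = h0 \<and> set (snd s) \<subseteq> S \<and>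
    (\<forall>h\<in>set (snd s). (fst s, cur h) \<in> le G)" for n and s :: "'p \<times> 'h list"
  define Nxt where "Nxt n s s' \<longleftrightarrow> (fst s', fst s) \<in> le G \<and> (\<exists>h'. snd s' = snd s @ [h'] \<and>
     (case prod_decode n of (i, l) \<Rightarrow>
       (\<exists>h''. ext l (snd s ! i) h'' \<and> (ent h'', fst s) \<in> le_star G) \<longrightarrow> ext l (snd s ! i) h'))"
    for n and s s' :: "'p \<times> 'h list"
  have "\<exists>f. \<forall>n. Inv n (f n) \<and> Nxt n (f n) (f (Suc n))"
  proof (rule dependent_nat_choice)
    show "\<exists>s. Inv 0 s"
      using h0 gowers_le_refl[OF G] by (intro exI[of _ "(cur h0, [h0])"]) (simp add: Inv_def)
    fix s n assume inv: "Inv n s"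
    obtain r hs where s: "s = (r, hs)" by (cases s)
    obtain i l where il: "prod_decode n = (i, l)" by (cases "prod_decode n")
    have len: "length hs = Suc n" and hsS: "set hs \<subseteq> S" and le_hs: "\<forall>h\<in>set hs. (r, cur h) \<in> le G"
      and hs0: "hs ! 0 = h0"
      using inv unfolding Inv_def s by auto
    have "prod_encode (i, l) = n" by (metis il prod_decode_inverse)
    then have "i < length hs" using le_prod_encode_1[of i l] len by simp
    then have hi: "hs ! i \<in> set hs" by simp
    show "\<exists>s'. Inv (Suc n) s' \<and> Nxt n s s'"
    proof (cases "\<exists>h''. ext l (hs ! i) h'' \<and> (ent h'', r) \<in> le_star G")
      case True
      then obtain h' where h': "ext l (hs ! i) h'" "(ent h', r) \<in> le_star G" by blast
      have h'S: "h' \<in> S" "(cur h', ent h') \<in> le G"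
        using ext[OF _ h'(1)] hi hsS by auto
      have "(cur h', r) \<in> le_star G"
        using h'S(2) h'(2) gowers_le_imp_le_star[OF G] gowers_le_star_trans[OF G] by metis
      then obtain r' where r': "(r', cur h') \<in> le G" "(r', r) \<in> le G"
        using gowers_refine[OF G] by metis
      have "\<forall>h\<in>set hs. (r', cur h) \<in> le G"
        using le_hs r'(2) gowers_le_trans[OF G] by metis
      then have "Inv (Suc n) (r', hs @ [h'])"
        using len hsS h'S(1) r'(1) hs0 by (auto simp: Inv_def nth_append)
      moreover have "Nxt n s (r', hs @ [h'])"
        using r'(2) h' unfolding Nxt_def s il by auto
      ultimately show ?thesis by blast
    next
      \<comment> \<open>Nothing to realise: selecting \<open>h0\<close> again keeps the numbering of the states uniform.\<close>
      case False
      have "hs ! 0 \<in> set hs" using len by simp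
      then have "(r, cur h0) \<in> le G" using hs0 le_hs by auto
      then have "Inv (Suc n) (r, hs @ [h0])"
        using len hsS le_hs h0(1) hs0 by (auto simp: Inv_def nth_append)
      moreover have "Nxt n s (r, hs @ [h0])"
        using False gowers_le_refl[OF G] gowers_le_carrier[OF G] \<open>(r, cur h0) \<in> le G\<close>
        unfolding Nxt_def s il by auto
      ultimately show ?thesis by blast
    qed
  qed
  then obtain f where f: "\<And>n. Inv n (f n)" "\<And>n. Nxt n (f n) (f (Suc n))" by blast
  define r where "r n = fst (f n)" for n
  define hs where "hs n = snd (f n)" for n
  have len: "length (hs n) = Suc n" and hsS: "set (hs n) \<subseteq> S"
    and le_hs: "\<And>h. h \<in> set (hs n) \<Longrightarrow> (r n, cur h) \<in> le G" for n
    using f(1)[of n] unfolding Inv_def hs_def r_def by auto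
  have hs0: "hs 0 = [h0]"
    using f(1)[of 0] unfolding Inv_def hs_def by (cases "snd (f 0)") auto
  have decr: "(r (Suc n), r n) \<in> le G" for n
    using f(2)[of n] unfolding Nxt_def r_def by blast
  have stable: "hs n ! i = hs i ! i" if "i \<le> n" for i n
    using that
  proof (induction n rule: dec_induct)
    case (step n)
    obtain h' where "hs (Suc n) = hs n @ [h']"
      using f(2)[of n] unfolding Nxt_def hs_def by blast
    then show ?case using step len[of n] by (simp add: nth_append)
  qed simp
  have rP: "r n \<in> Pset G" for n
    using decr gowers_le_carrier[OF G] by metis
  obtain q' where q': "\<And>n. (q', r n) \<in> le_star G"
    using gowers_diagonal[OF G, of r] rP decr by metis
  \<comment> \<open>The diagonal bound \<open>q'\<close> need not be below \<open>r 0\<close>, so it is refined once more.\<close>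
  obtain q where q: "(q, r 0) \<in> le G" "(q, q') \<in> le G"
    using gowers_refine[OF G q'[of 0]] by metis
  have qr: "(q, r n) \<in> le_star G" for n
    using q(2) q' gowers_le_imp_le_star[OF G] gowers_le_star_trans[OF G] by metis
  define W where "W = (\<Union>n. set (hs n))"
  show ?thesis
  proof (intro exI[of _ q] exI[of _ W] conjI ballI allI impI)
    show "(q, cur h0) \<in> le G"
      using q(1) le_hs[of h0 0] hs0 gowers_le_trans[OF G] by (metis list.set_intros(1))
    show "h0 \<in> W" unfolding W_def using hs0 by (intro UN_I[of 0]) auto
    show "W \<subseteq> S" unfolding W_def using hsS by blast
    show "(q, cur h) \<in> le_star G" if "h \<in> W" for h
    proof -
      obtain n where "h \<in> set (hs n)" using \<open>h \<in> W\<close> unfolding W_def by blast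
      then show ?thesis
        using le_hs qr[of n] gowers_le_imp_le_star[OF G] gowers_le_star_trans[OF G] by metis
    qed
    show "\<exists>h''\<in>W. ext l h h''" if hW: "h \<in> W" and e: "ext l h h'" "(ent h', q) \<in> le_star G" for l h h'
    proof -
      obtain m i where "i < length (hs m)" "h = hs m ! i"
        using hW unfolding W_def by (metis UN_E in_set_conv_nth)
      then have hi: "h = hs i ! i" using stable[of i m] len[of m] by simp
      define n where "n = prod_encode (i, l)"
      have "h = hs n ! i" using hi stable[of i n] le_prod_encode_1[of i l] by (simp add: n_def)
      moreover have "(ent h', r n) \<in> le_star G"
        using e(2) qr gowers_le_star_trans[OF G] by metis
      ultimately obtain h'' where "hs (Suc n) = hs n @ [h'']" "ext l h h''"
        using f(2)[of n] e(1) unfolding Nxt_def hs_def r_def n_def by auto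
      then show ?thesis unfolding W_def by (intro bexI[of _ h''] UN_I[of "Suc n"]) auto
    qed
  qed
qed

section \<open>The game of Kastanas\<close>

text \<open>
  The game of Kastanas below \<open>p\<close>.  A move \<open>m\<close> stands for the point \<open>\<alpha> m\<close> and the subspace \<open>\<rho> m\<close>.  Player I
  moves at even and II at odd times.  Move 0 is idle, move 1 is the opening subspace of II, whose
  point is disregarded, and from then on the moves are \<open>(x\<^sub>0, q\<^sub>0)\<close>, \<open>(y\<^sub>0, p\<^sub>1)\<close>, and so on.
  Thus the outcome consists of the points played from time 2 on.
\<close>

locale kastanas_game =
  fixes G :: "('p, 'x) gowers" and p :: 'p and \<alpha> :: "'m \<Rightarrow> 'x" and \<rho> :: "'m \<Rightarrow> 'p"
  assumes G: "gowers_space G" and p: "p \<in> Pset G"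
    and decode: "range (\<lambda>m. (\<alpha> m, \<rho> m)) = Xset G \<times> Pset G"
begin

text \<open>
  The subspace in force after \<open>h\<close>, which bounds the next subspace and constrains the next point; the
  idle move leaves \<open>p\<close> in force.
\<close>

definition cur :: "'m list \<Rightarrow> 'p" where
  "cur h = (if length h \<le> 1 then p else \<rho> (last h))"

definition legal :: "'m list \<Rightarrow> 'm \<Rightarrow> bool" where
  "legal h m \<longleftrightarrow> h = [] \<or> ((\<rho> m, cur h) \<in> le G \<and>
     (2 \<le> length h \<longrightarrow> (map \<alpha> (drop 2 (h @ [m])), cur h) \<in> tri G))"

definition legal_at :: "(nat \<Rightarrow> 'm) \<Rightarrow> nat \<Rightarrow> bool" where
  "legal_at z n \<longleftrightarrow> legal (map z [0..<n]) (z n)"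

text \<open>
  The players are named by the parity of their moves: \<open>b = True\<close> is I, and \<open>b = False\<close> is II.
\<close>

definition follows :: "bool \<Rightarrow> ('m list \<Rightarrow> 'm) \<Rightarrow> (nat \<Rightarrow> 'm) \<Rightarrow> bool" where
  "follows b \<sigma> z \<longleftrightarrow> (\<forall>n. even n = b \<longrightarrow> z n = \<sigma> (map z [0..<n]))"

definition winning :: "bool \<Rightarrow> ('m list \<Rightarrow> 'm) \<Rightarrow> (nat \<Rightarrow> 'x) set \<Rightarrow> bool" where
  "winning b \<sigma> Y \<longleftrightarrow> (\<forall>z. follows b \<sigma> z \<longrightarrow>
     (\<forall>n. even n = b \<longrightarrow> (\<forall>m<n. legal_at z m) \<longrightarrow> legal_at z n) \<and>
     ((\<forall>n. legal_at z n) \<longrightarrow> (\<lambda>n. \<alpha> (z (n + 2))) \<in> Y))"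

definition position :: "bool \<Rightarrow> ('m list \<Rightarrow> 'm) \<Rightarrow> 'm list \<Rightarrow> bool" where
  "position b \<sigma> h \<longleftrightarrow>
     (\<forall>n<length h. legal (take n h) (h ! n) \<and> (even n = b \<longrightarrow> h ! n = \<sigma> (take n h)))"

lemma \<alpha>_in: "\<alpha> m \<in> Xset G" and \<rho>_in: "\<rho> m \<in> Pset G"
  using rangeI[of "\<lambda>m. (\<alpha> m, \<rho> m)" m] unfolding decode by simp_all

lemma cur_in: "cur h \<in> Pset G"
  by (simp add: cur_def p \<rho>_in)

lemma position_snoc:
  "position b \<sigma> (h @ [m]) \<longleftrightarrow>
     position b \<sigma> h \<and> legal h m \<and> (even (length h) = b \<longrightarrow> m = \<sigma> h)"
  unfolding position_def by (auto simp: nth_append less_Suc_eq)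

lemma run_exists:
  "\<exists>z. follows b \<sigma> z \<and> (\<forall>n. even n \<noteq> b \<longrightarrow> z n = o' n)"
proof -
  define H where "H = rec_nat [] (\<lambda>n h. h @ [if even n = b then \<sigma> h else o' n])"
  define z where "z n = last (H (Suc n))" for n
  have Hz: "map z [0..<n] = H n" for n
    by (induction n) (simp_all add: H_def z_def)
  have "z n = (if even n = b then \<sigma> (map z [0..<n]) else o' n)" for n
    unfolding Hz by (simp add: z_def H_def)
  then show ?thesis unfolding follows_def by metis
qed

text \<open>
  A winning strategy prescribes legal moves at every legal position: otherwise an arbitrary
  continuation of the position would be a run in which its owner is the first to break a rule.
\<close>

lemma position_extend:
  assumes win: "winning b \<sigma> Y" and pos: "position b \<sigma> h" and turn: "even (length h) = b"
  shows "position b \<sigma> (h @ [\<sigma> h])"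
proof -
  \<comment> \<open>Past the end of \<open>h\<close> the opponent's moves are arbitrary.\<close>
  obtain z where z: "follows b \<sigma> z" "\<And>n. even n \<noteq> b \<Longrightarrow> z n = h ! n"
    using run_exists[of b \<sigma> "\<lambda>n. h ! n"] by blast
  have pre: "map z [0..<n] = take n h" if "n \<le> length h" for n
    using that
  proof (induction n)
    case (Suc n)
    then have IH: "map z [0..<n] = take n h" and n: "n < length h" by auto
    have "z n = h ! n"
      using z IH pos n unfolding follows_def position_def by (cases "even n = b") auto
    then show ?case using IH n by (simp add: take_Suc_conv_app_nth)
  qed simp
  have at: "z n = h ! n" if "n < length h" for n
    using pre[of "Suc n"] pre[of n] that by (simp add: take_Suc_conv_app_nth)
  have "legal_at z m" if "m < length h" for m
    using pos pre[of m] at[OF that] that unfolding legal_at_def position_def by simp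
  then have "legal_at z (length h)"
    using win z(1) turn unfolding winning_def by blast
  moreover have "z (length h) = \<sigma> h"
    using z(1) turn pre[of "length h"] unfolding follows_def by simp
  ultimately show ?thesis
    using pos pre[of "length h"] unfolding legal_at_def position_snoc by simp
qed

section \<open>From the game of Kastanas to the adversarial games\<close>

text \<open>
  Fusion over the positions at which the owner of the strategy has just moved; a transition is one
  round, labelled by the opponent's point and the point of the reply, and triggered by the opponent's
  subspace.  The subspace \<open>Q h\<close> is what the owner plays at \<open>h\<close> instead of the subspace prescribed
  by the strategy.

  The last clause is the heart of the simulation: any point that is legal for the opponent, with any
  \<open>r \<le> q\<close>, is answered inside \<open>W\<close>.  The subspace played in \<open>W\<close> need not lie below \<open>r\<close>, but the word
  of points is the one that arises from a subspace below \<open>r\<close>, so it is legal for \<open>r\<close>.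
\<close>

lemma reply_table:
  assumes win: "winning b \<sigma> Y"
    and h0: "position b \<sigma> h0" "h0 \<noteq> []" "even (length h0) \<noteq> b"
  shows "\<exists>q W Q. (q, cur h0) \<in> le G \<and> h0 \<in> W \<and> (\<forall>h\<in>W. position b \<sigma> h) \<and>
    (\<forall>h\<in>W. lessapprox G (Q h) q \<and> (Q h, cur h) \<in> le G) \<and>
    (\<forall>h\<in>W. \<forall>x\<in>Xset G. \<forall>r. (r, q) \<in> le G \<longrightarrow>
       (2 \<le> length h \<longrightarrow> (map \<alpha> (drop 2 h) @ [x], cur h) \<in> tri G) \<longrightarrow>
       (\<exists>m. \<alpha> m = x \<and> h @ [m, \<sigma> (h @ [m])] \<in> W \<and>
           (map \<alpha> (drop 2 (h @ [m, \<sigma> (h @ [m])])), r) \<in> tri G))"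
proof -
  define S where "S = {h. position b \<sigma> h \<and> h \<noteq> [] \<and> even (length h) \<noteq> b}"
  define lab :: "nat \<Rightarrow> 'x \<times> 'x" where "lab = from_nat_into (Xset G \<times> Xset G)"
  define ext where "ext l h h' \<longleftrightarrow>
    (\<exists>m. h' = h @ [m, \<sigma> (h @ [m])] \<and> legal h m \<and> lab l = (\<alpha> m, \<alpha> (\<sigma> (h @ [m]))))" for l h h'
  define ent where "ent h = \<rho> (last (butlast h))" for h
  have S_step: "h @ [m, \<sigma> (h @ [m])] \<in> S \<and> (\<rho> (\<sigma> (h @ [m])), \<rho> m) \<in> le G \<and>
      (map \<alpha> (drop 2 (h @ [m, \<sigma> (h @ [m])])), \<rho> m) \<in> tri G"
    if h: "h \<in> S" and m: "legal h m" for h m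
  proof -
    have "position b \<sigma> (h @ [m])"
      using h m unfolding S_def position_snoc by simp
    then have "position b \<sigma> ((h @ [m]) @ [\<sigma> (h @ [m])])"
      by (rule position_extend[OF win]) (use h in \<open>auto simp: S_def\<close>)
    moreover from this have "legal (h @ [m]) (\<sigma> (h @ [m]))"
      unfolding position_snoc[of b \<sigma> "h @ [m]"] by simp
    moreover have "cur (h @ [m]) = \<rho> m" "2 \<le> length (h @ [m])"
      using h by (cases h; simp add: S_def cur_def)+
    ultimately show ?thesis
      using h unfolding S_def legal_def by auto
  qed
  have "h' \<in> S \<and> (cur h', ent h') \<in> le G" if hS: "h \<in> S" and e: "ext l h h'" for l h h'
  proof -
    obtain m where m: "h' = h @ [m, \<sigma> (h @ [m])]" "legal h m"
      using e unfolding ext_def by blast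
    have "cur h' = \<rho> (\<sigma> (h @ [m]))" "ent h' = \<rho> m"
      unfolding m(1) cur_def ent_def by (simp_all add: butlast_append)
    then show ?thesis using S_step[OF hS m(2)] m(1) by simp
  qed
  then have ext_S: "\<forall>h\<in>S. \<forall>l h'. ext l h h' \<longrightarrow> h' \<in> S \<and> (cur h', ent h') \<in> le G" by simp
  have "h0 \<in> S" using h0 by (simp add: S_def)
  obtain q W where q: "(q, cur h0) \<in> le G" and W: "h0 \<in> W" "W \<subseteq> S"
    and qW: "\<forall>h\<in>W. (q, cur h) \<in> le_star G"
    and closed: "\<forall>h\<in>W. \<forall>l h'. ext l h h' \<longrightarrow> (ent h', q) \<in> le_star G \<longrightarrow> (\<exists>h''\<in>W. ext l h h'')"
    using gowers_fusion[where ext = ext and cur = cur and ent = ent, OF G \<open>h0 \<in> S\<close> cur_in ext_S]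
    by (elim exE conjE)
  note qW = bspec[OF qW] and closed = closed[rule_format]
  have "\<forall>h\<in>W. \<exists>r. lessapprox G r q \<and> (r, cur h) \<in> le G"
    using gowers_refine[OF G] qW unfolding lessapprox_def by blast
  then obtain Q where Q: "\<And>h. h \<in> W \<Longrightarrow> lessapprox G (Q h) q \<and> (Q h, cur h) \<in> le G"
    by metis
  show ?thesis
  proof (intro exI[of _ q] exI[of _ W] exI[of _ Q] conjI ballI allI impI)
    show "position b \<sigma> h" if "h \<in> W" for h using that W(2) unfolding S_def by blast
    fix h x r
    assume h: "h \<in> W" and x: "x \<in> Xset G" and r: "(r, q) \<in> le G"
      and leg: "2 \<le> length h \<longrightarrow> (map \<alpha> (drop 2 h) @ [x], cur h) \<in> tri G"
    have hS: "h \<in> S" using h W(2) by blast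
    have "(r, cur h) \<in> le_star G"
      using r qW[OF h] gowers_le_imp_le_star[OF G] gowers_le_star_trans[OF G] by metis
    \<comment> \<open>The subspace \<open>r'\<close> is the one with which the opponent's move is imitated.\<close>
    then obtain r' where r': "(r', r) \<in> le G" "(r', cur h) \<in> le G"
      using gowers_refine[OF G] by metis
    have "(x, r') \<in> range (\<lambda>m. (\<alpha> m, \<rho> m))"
      unfolding decode using x r' gowers_le_carrier[OF G] by blast
    then obtain m where m: "\<alpha> m = x" "\<rho> m = r'" by auto
    have lm: "legal h m"
      using r'(2) leg m unfolding legal_def by simp
    define s where "s = \<sigma> (h @ [m])"
    have "lab (to_nat_on (Xset G \<times> Xset G) (x, \<alpha> s)) = (x, \<alpha> s)"
      unfolding lab_def using x \<alpha>_in gowers_X(1)[OF G] by simp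
    then have e: "ext (to_nat_on (Xset G \<times> Xset G) (x, \<alpha> s)) h (h @ [m, s])"
      unfolding ext_def using lm m(1) s_def by auto
    have "(ent (h @ [m, s]), q) \<in> le_star G"
      using r'(1) r gowers_le_trans[OF G] gowers_le_imp_le_star[OF G] m(2)
      by (simp add: ent_def butlast_append)
    from closed[OF h e this] obtain m' where m': "h @ [m', \<sigma> (h @ [m'])] \<in> W" "\<alpha> m' = x"
        "\<alpha> (\<sigma> (h @ [m'])) = \<alpha> s"
      unfolding ext_def using \<open>lab _ = (x, \<alpha> s)\<close> by auto
    have "map \<alpha> (drop 2 (h @ [m', \<sigma> (h @ [m'])])) = map \<alpha> (drop 2 (h @ [m, s]))"
      using m' m(1) by (simp only: drop_map[symmetric] map_append) (simp add: s_def)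
    moreover have "(map \<alpha> (drop 2 (h @ [m, s])), r) \<in> tri G"
      using S_step[OF hS lm] r'(1) gowers_tri_mono[OF G] unfolding s_def m(2) by metis
    ultimately show "\<exists>m. \<alpha> m = x \<and> h @ [m, \<sigma> (h @ [m])] \<in> W \<and>
        (map \<alpha> (drop 2 (h @ [m, \<sigma> (h @ [m])])), r) \<in> tri G"
      using m' by metis
  qed (use q W(1) Q in simp_all)
qed

text \<open>
  Legality of the opponent's \<open>j\<close>-th move \<open>a j\<close>, made at time \<open>c + 2 j\<close>, in the game in which the
  opponent plays below \<open>q\<close> and the other player's subspaces are given by \<open>Q\<close>.  The sequence \<open>v\<close> is the
  outcome shifted by two places, as in the game of Kastanas.
\<close>

definition opponent_legal :: "'p \<Rightarrow> (('x \<times> 'p) list \<Rightarrow> 'p) \<Rightarrow> nat \<Rightarrow> (nat \<Rightarrow> 'x \<times> 'p) \<Rightarrow> (nat \<Rightarrow> 'x) \<Rightarrow> nat \<Rightarrow> bool"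
  where "opponent_legal q Q c a v j \<longleftrightarrow> fst (a j) \<in> Xset G \<and> (snd (a j), q) \<in> le G \<and>
    (2 \<le> c + 2 * j \<longrightarrow> (map v [2..<Suc (c + 2 * j)], Q (map a [0..<j])) \<in> tri G)"

text \<open>
  The simulation with its positions hidden.  The number \<open>c\<close> is the time of the opponent's first move:
  1 if the owner of the strategy is I, and 2 if it is II.  The functions \<open>w\<close> and \<open>Q\<close> turn the list of the
  opponent's moves into the point and the subspace to be played.
\<close>

lemma strategy_without_subspaces:
  assumes win: "winning b \<sigma> Y"
    and h0: "position b \<sigma> h0" "h0 \<noteq> []" "even (length h0) \<noteq> b" and c: "length h0 = c" "c \<le> 2"
  shows "\<exists>q w Q. (q, cur h0) \<in> le G \<and> (\<forall>a v.
     (\<forall>j. v (c + 2 * j) = fst (a j)) \<longrightarrow> (\<forall>j. v (Suc (c + 2 * j)) = w (map a [0..<Suc j])) \<longrightarrow>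
     (\<forall>i. (\<forall>j<i. opponent_legal q Q c a v j) \<longrightarrow>
        w (map a [0..<i]) \<in> Xset G \<and> lessapprox G (Q (map a [0..<i])) q \<and>
        (\<forall>j. i = Suc j \<longrightarrow> (map v [2..<c + 2 * i], snd (a j)) \<in> tri G)) \<and>
     ((\<forall>j. opponent_legal q Q c a v j) \<longrightarrow> (\<lambda>n. v (n + 2)) \<in> Y))"
proof -
  obtain q W Q where q: "(q, cur h0) \<in> le G" and W0: "h0 \<in> W"
    and posW: "\<forall>h\<in>W. position b \<sigma> h"
    and Q: "\<forall>h\<in>W. lessapprox G (Q h) q \<and> (Q h, cur h) \<in> le G"
    and rep: "\<forall>h\<in>W. \<forall>x\<in>Xset G. \<forall>r. (r, q) \<in> le G \<longrightarrow>
       (2 \<le> length h \<longrightarrow> (map \<alpha> (drop 2 h) @ [x], cur h) \<in> tri G) \<longrightarrow>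
       (\<exists>m. \<alpha> m = x \<and> h @ [m, \<sigma> (h @ [m])] \<in> W \<and>
           (map \<alpha> (drop 2 (h @ [m, \<sigma> (h @ [m])])), r) \<in> tri G)"
    using reply_table[OF win h0] by (elim exE conjE)
  note Q = Q[rule_format] and posW = posW[rule_format]
  define pick where "pick h a = (SOME m. \<alpha> m = fst a \<and> h @ [m, \<sigma> (h @ [m])] \<in> W \<and>
      (map \<alpha> (drop 2 (h @ [m, \<sigma> (h @ [m])])), snd a) \<in> tri G)" for h a
  \<comment> \<open>The simulated position; \<open>pick\<close> is only meaningful against legal moves, but rounds are always
    added, so that lengths and the prefix relation do not depend on legality.\<close>
  define st where "st = foldl (\<lambda>h a. h @ [pick h a, \<sigma> (h @ [pick h a])]) h0"
  define w where "w as = \<alpha> (last (st as))" for as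
  have core: "(\<forall>i. (\<forall>j<i. opponent_legal q (\<lambda>as. Q (st as)) c a v j) \<longrightarrow>
        w (map a [0..<i]) \<in> Xset G \<and> lessapprox G (Q (st (map a [0..<i]))) q \<and>
        (\<forall>j. i = Suc j \<longrightarrow> (map v [2..<c + 2 * i], snd (a j)) \<in> tri G)) \<and>
     ((\<forall>j. opponent_legal q (\<lambda>as. Q (st as)) c a v j) \<longrightarrow> (\<lambda>n. v (n + 2)) \<in> Y)"
    if v0: "\<forall>j. v (c + 2 * j) = fst (a j)" and v1: "\<forall>j. v (Suc (c + 2 * j)) = w (map a [0..<Suc j])"
    for a :: "nat \<Rightarrow> 'x \<times> 'p" and v
  proof -
    define H where "H j = st (map a [0..<j])" for j
    define mv where "mv j = pick (H j) (a j)" for j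
    have H0: "H 0 = h0" and HS: "H (Suc j) = H j @ [mv j, \<sigma> (H j @ [mv j])]" for j
      by (simp_all add: H_def st_def mv_def)
    have lenH: "length (H j) = c + 2 * j" for j
      by (induction j) (simp_all add: H0 HS c(1))
    define z where "z n = H n ! n" for n
    have stable: "H k ! n = H i ! n" if "n < length (H i)" "i \<le> k" for n i k
      using that(2)
    proof (induction k rule: dec_induct)
      case (step k)
      then show ?case using that(1) lenH[of i] lenH[of k] by (simp add: HS nth_append)
    qed simp
    have c1: "1 \<le> c" using h0(2) c(1) by (cases h0) auto
    have zH: "z n = H i ! n" if "n < c + 2 * i" for n i
    proof (cases "i \<le> n")
      case True
      then show ?thesis using stable[of n i n] that lenH by (simp add: z_def)
    next
      case False
      then show ?thesis using stable[of n n i] c1 lenH[of n] by (simp add: z_def)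
    qed
    have Hz: "H i = map z [0..<c + 2 * i]" for i
      by (rule nth_equalityI) (simp_all add: lenH zH)
    have dropz: "map \<alpha> (drop 2 (map z [0..<k])) = map (\<lambda>n. \<alpha> (z n)) [2..<k]" for k
      by (simp add: drop_map comp_def numeral_2_eq_2)
    define valid where valid_eq: "valid = opponent_legal q (\<lambda>as. Q (st as)) c a v"
    have valid_def: "valid j \<longleftrightarrow> fst (a j) \<in> Xset G \<and> (snd (a j), q) \<in> le G \<and>
        (2 \<le> c + 2 * j \<longrightarrow> (map v [2..<Suc (c + 2 * j)], Q (H j)) \<in> tri G)" for j
      by (simp add: valid_eq opponent_legal_def H_def)
    have vlast: "v (Suc (c + 2 * j)) = \<alpha> (z (Suc (c + 2 * j)))" for j
    proof -
      have "H (Suc j) \<noteq> []" by (simp add: HS)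
      then have "last (H (Suc j)) = z (Suc (c + 2 * j))"
        using lenH[of "Suc j"] zH[of "Suc (c + 2 * j)" "Suc j"] by (simp add: last_conv_nth)
      then show ?thesis using v1 unfolding w_def H_def by (metis)
    qed
    have main: "H i \<in> W \<and> (\<forall>n. 2 \<le> n \<longrightarrow> n < c + 2 * i \<longrightarrow> v n = \<alpha> (z n)) \<and>
        (\<forall>j. i = Suc j \<longrightarrow> (map v [2..<c + 2 * i], snd (a j)) \<in> tri G)"
      if "\<forall>j<i. valid j" for i
      using that
    proof (induction i)
      case 0
      then show ?case using W0 H0 c by simp
    next
      case (Suc i)
      then have IH: "H i \<in> W" "\<forall>n. 2 \<le> n \<longrightarrow> n < c + 2 * i \<longrightarrow> v n = \<alpha> (z n)"
        and val: "valid i" by auto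
      have agree: "map v [2..<c + 2 * i] = map \<alpha> (drop 2 (H i))"
        unfolding Hz dropz using IH(2) by simp
      have *: "\<exists>m. \<alpha> m = fst (a i) \<and> H i @ [m, \<sigma> (H i @ [m])] \<in> W \<and>
           (map \<alpha> (drop 2 (H i @ [m, \<sigma> (H i @ [m])])), snd (a i)) \<in> tri G"
      proof (rule rep[rule_format, OF IH(1)])
        show "fst (a i) \<in> Xset G" "(snd (a i), q) \<in> le G" using val by (auto simp: valid_def)
        assume "2 \<le> length (H i)"
        then have two: "2 \<le> c + 2 * i" by (simp add: lenH)
        then have "(map v [2..<c + 2 * i] @ [fst (a i)], Q (H i)) \<in> tri G"
          using val v0 by (simp add: valid_def)
        then show "(map \<alpha> (drop 2 (H i)) @ [fst (a i)], cur (H i)) \<in> tri G"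
          unfolding agree using Q[OF IH(1)] gowers_tri_mono[OF G] by metis
      qed
      from someI_ex[OF *] have m: "\<alpha> (mv i) = fst (a i)" "H (Suc i) \<in> W"
          "(map \<alpha> (drop 2 (H (Suc i))), snd (a i)) \<in> tri G"
        unfolding HS mv_def pick_def by blast+
      have "z (c + 2 * i) = mv i"
        using zH[of "c + 2 * i" "Suc i"] lenH[of i] by (simp add: HS nth_append)
      then have "v (c + 2 * i) = \<alpha> (z (c + 2 * i))" using v0 m(1) by simp
      then have new: "\<forall>n. 2 \<le> n \<longrightarrow> n < c + 2 * Suc i \<longrightarrow> v n = \<alpha> (z n)"
        using IH(2) vlast[of i] by (auto simp: less_Suc_eq)
      have "map v [2..<c + 2 * Suc i] = map \<alpha> (drop 2 (H (Suc i)))"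
        unfolding Hz dropz by (rule map_cong[OF refl]) (use new in \<open>simp del: upt_Suc\<close>)
      then show ?case using m new by simp
    qed
    show ?thesis
      unfolding valid_eq[symmetric]
    proof (intro conjI allI impI)
      fix i assume "\<forall>j<i. valid j"
      note m = main[OF this]
      show "w (map a [0..<i]) \<in> Xset G" by (simp add: w_def \<alpha>_in)
      show "lessapprox G (Q (st (map a [0..<i]))) q" using Q m by (simp add: H_def)
      show "(map v [2..<c + 2 * i], snd (a j)) \<in> tri G" if "i = Suc j" for j using m that by simp
    next
      assume "\<forall>j. valid j"
      then have m: "H i \<in> W" "\<And>n. 2 \<le> n \<Longrightarrow> n < c + 2 * i \<Longrightarrow> v n = \<alpha> (z n)" for i
        using main[of i] by simp_all
      have pos: "legal_at z n \<and> (even n = b \<longrightarrow> z n = \<sigma> (map z [0..<n]))" for n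
      proof -
        have "n < length (H n)" using c1 by (simp add: lenH)
        moreover have "take n (H n) = map z [0..<n]" "H n ! n = z n"
          using c1 by (simp_all add: Hz take_map)
        ultimately show ?thesis
          using posW[OF m(1)[of n]] unfolding position_def legal_at_def by metis
      qed
      then have "follows b \<sigma> z" "\<forall>n. legal_at z n" by (simp_all add: follows_def)
      then have "(\<lambda>n. \<alpha> (z (n + 2))) \<in> Y" using win unfolding winning_def by simp
      moreover have "v (n + 2) = \<alpha> (z (n + 2))" for n
        by (rule m(2)[of _ "n + 2"]) (use c1 in auto)
      ultimately show "(\<lambda>n. v (n + 2)) \<in> Y" by simp
    qed
  qed
  show ?thesis
    by (intro exI[of _ q] exI[of _ w] exI[of _ "\<lambda>as. Q (st as)"] conjI[OF q] allI)
      (intro impI, rule core, assumption+)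
qed

lemma outcome_prefix: "map (\<lambda>n. outcome x y (n - 2)) [2..<k + 2] = map (outcome x y) [0..<k]"
  by (rule nth_equalityI) (simp_all del: upt_Suc)

text \<open>
  The opponent's moves are re-bracketed: the opening subspace of II is paired with a dummy point \<open>d\<close>, which
  occupies time 1 and so is not part of the outcome.
\<close>

lemma I_wins_imp_reaches_in_A:
  assumes win: "winning True \<sigma> Y"
  shows "\<exists>q\<in>Pset G. (q, p) \<in> le G \<and> I_reaches_in_A G q Y"
proof -
  have pos: "position True \<sigma> [\<sigma> []]"
    by (simp add: position_def legal_def)
  have start: "[\<sigma> []] \<noteq> []" "even (length [\<sigma> []]) \<noteq> True" "length [\<sigma> []] = 1" "(1::nat) \<le> 2"
    by simp_all
  obtain q w Q where q: "(q, cur [\<sigma> []]) \<in> le G" and play: "\<forall>a v.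
     (\<forall>j. v (1 + 2 * j) = fst (a j)) \<longrightarrow> (\<forall>j. v (Suc (1 + 2 * j)) = w (map a [0..<Suc j])) \<longrightarrow>
     (\<forall>i. (\<forall>j<i. opponent_legal q Q 1 a v j) \<longrightarrow>
        w (map a [0..<i]) \<in> Xset G \<and> lessapprox G (Q (map a [0..<i])) q \<and>
        (\<forall>j. i = Suc j \<longrightarrow> (map v [2..<1 + 2 * i], snd (a j)) \<in> tri G)) \<and>
     ((\<forall>j. opponent_legal q Q 1 a v j) \<longrightarrow> (\<lambda>n. v (n + 2)) \<in> Y)"
    using strategy_without_subspaces[OF win pos start] by (elim exE conjE)
  have qp: "(q, p) \<in> le G" using q by (simp add: cur_def)
  obtain d where d: "d \<in> Xset G" using gowers_X(2)[OF G] by blast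
  define \<tau> where "\<tau> p0 as = (w ((d, p0) # as), Q ((d, p0) # as))" for p0 as
  have "wins_I G (\<lambda>r. lessapprox G r q) (\<lambda>r. (r, q) \<in> le G) Y ps x qs y"
    if run: "\<And>i. (x i, qs i) = \<tau> (ps 0) (map (\<lambda>j. (y j, ps (Suc j))) [0..<i])" for ps x qs y
  proof -
    define a where "a j = (case j of 0 \<Rightarrow> (d, ps 0) | Suc k \<Rightarrow> (y k, ps (Suc k)))" for j
    define v where "v n = (if n < 2 then d else outcome x y (n - 2))" for n
    have as: "map a [0..<Suc i] = (d, ps 0) # map (\<lambda>j. (y j, ps (Suc j))) [0..<i]" for i
      by (simp add: a_def upt_conv_Cons map_Suc_upt[symmetric] comp_def del: upt_Suc)
    have xq: "x i = w (map a [0..<Suc i])" "qs i = Q (map a [0..<Suc i])" for i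
      using run[of i] unfolding \<tau>_def as by simp_all
    have v0: "v (1 + 2 * j) = fst (a j)" for j
      by (cases j) (simp_all add: v_def a_def outcome_def)
    have v1: "v (Suc (1 + 2 * j)) = w (map a [0..<Suc j])" for j
      by (simp add: v_def outcome_def xq)
    have vpre: "map v [2..<k + 2] = map (outcome x y) [0..<k]" for k
      by (subst outcome_prefix[symmetric], rule map_cong[OF refl]) (simp add: v_def del: upt_Suc)
    define LI where "LI = legal_I G (\<lambda>r. lessapprox G r q) ps x qs y"
    define LII where "LII = legal_II G (\<lambda>r. (r, q) \<in> le G) ps x qs y"
    note main = play[rule_format, OF v0 v1]
    have adm: "opponent_legal q Q 1 a v j" if "LII j" for j
    proof (cases j)
      case 0
      then show ?thesis
        using that d by (simp add: LII_def legal_II_def opponent_legal_def a_def)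
    next
      case (Suc k)
      have "map v [2..<Suc (1 + 2 * j)] = map (outcome x y) [0..<2 * j]"
        using vpre[of "2 * j"] by simp
      then show ?thesis
        using that Suc xq(2)[of k] by (simp add: LII_def legal_II_def opponent_legal_def a_def del: upt_Suc)
    qed
    have step: "LI i" if "\<forall>j\<le>i. LII j" for i
    proof -
      have "\<forall>j<Suc i. opponent_legal q Q 1 a v j" using that adm by simp
      then have "x i \<in> Xset G" "lessapprox G (qs i) q"
          "(map v [2..<1 + 2 * Suc i], snd (a i)) \<in> tri G"
        using main[THEN conjunct1, rule_format, of "Suc i"] xq by auto
      moreover have "map v [2..<1 + 2 * Suc i] = map (outcome x y) [0..<2 * i + 1]"
        using vpre[of "2 * i + 1"] by simp
      moreover have "snd (a i) = ps i" by (cases i) (simp_all add: a_def)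
      ultimately show ?thesis
        using gowers_le_carrier[OF G] unfolding LI_def legal_I_def lessapprox_def by auto
    qed
    show ?thesis
    proof (cases "\<forall>i. LII i")
      case True
      have "(\<lambda>n. v (n + 2)) \<in> Y" by (rule main[THEN conjunct2, rule_format], rule adm, rule True[rule_format])
      then have "outcome x y \<in> Y" by (simp add: v_def)
      then show ?thesis
        using True step unfolding wins_I_def LI_def[symmetric] LII_def[symmetric] by simp
    next
      case False
      define i where "i = (LEAST i. \<not> LII i)"
      have "\<not> LII i" "\<forall>j<i. LII j"
        unfolding i_def using False LeastI_ex[of "\<lambda>i. \<not> LII i"] not_less_Least by blast+
      then show ?thesis
        using step unfolding wins_I_def LI_def[symmetric] LII_def[symmetric]
        by (intro disjI1 exI[of _ i]) simp
    qed
  qed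
  then have "I_reaches_in_A G q Y"
    unfolding I_reaches_in_A_def I_can_reach_def by (intro exI[of _ \<tau>]) simp
  then show ?thesis using qp gowers_le_carrier[OF G qp] by blast
qed

text \<open>
  Here the simulation starts after the idle move of I and the opening subspace that the strategy
  plays against it.
\<close>

lemma II_wins_imp_reaches_in_B:
  assumes win: "winning False \<sigma> Y"
  shows "\<exists>q\<in>Pset G. (q, p) \<in> le G \<and> II_reaches_in_B G q Y"
proof -
  \<comment> \<open>Any move serves as the idle one.\<close>
  define m0 where "m0 = (undefined :: 'm)"
  have "position False \<sigma> [m0]"
    by (simp add: position_def legal_def)
  then have "position False \<sigma> ([m0] @ [\<sigma> [m0]])"
    by (rule position_extend[OF win]) simp
  then have pos: "position False \<sigma> [m0, \<sigma> [m0]]" by simp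
  then have "legal [m0] (\<sigma> [m0])"
    using position_snoc[of False \<sigma> "[m0]"] by simp
  then have cur0: "(cur [m0, \<sigma> [m0]], p) \<in> le G"
    by (simp add: legal_def cur_def)
  have start: "[m0, \<sigma> [m0]] \<noteq> []" "even (length [m0, \<sigma> [m0]]) \<noteq> False"
      "length [m0, \<sigma> [m0]] = 2" "(2::nat) \<le> 2"
    by simp_all
  obtain q w Q where q: "(q, cur [m0, \<sigma> [m0]]) \<in> le G" and play: "\<forall>a v.
     (\<forall>j. v (2 + 2 * j) = fst (a j)) \<longrightarrow> (\<forall>j. v (Suc (2 + 2 * j)) = w (map a [0..<Suc j])) \<longrightarrow>
     (\<forall>i. (\<forall>j<i. opponent_legal q Q 2 a v j) \<longrightarrow>
        w (map a [0..<i]) \<in> Xset G \<and> lessapprox G (Q (map a [0..<i])) q \<and>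
        (\<forall>j. i = Suc j \<longrightarrow> (map v [2..<2 + 2 * i], snd (a j)) \<in> tri G)) \<and>
     ((\<forall>j. opponent_legal q Q 2 a v j) \<longrightarrow> (\<lambda>n. v (n + 2)) \<in> Y)"
    using strategy_without_subspaces[OF win pos start] by (elim exE conjE)
  have qp: "(q, p) \<in> le G" using q cur0 gowers_le_trans[OF G] by metis
  define \<tau> where "\<tau> as = (w as, Q as)" for as
  have "wins_II G (\<lambda>r. (r, q) \<in> le G) (\<lambda>r. lessapprox G r q) Y ps x qs y"
    if run: "ps 0 = Q []" "\<And>i. (y i, ps (Suc i)) = \<tau> (map (\<lambda>j. (x j, qs j)) [0..<Suc i])" for ps x qs y
  proof -
    define a where "a j = (x j, qs j)" for j
    define v where "v n = outcome x y (n - 2)" for n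
    have y: "y i = w (map a [0..<Suc i])" for i
      using run(2)[of i] unfolding \<tau>_def a_def by (simp del: upt_Suc)
    have ps: "ps i = Q (map a [0..<i])" for i
      using run(1) run(2)[of "i - 1"] unfolding \<tau>_def a_def by (cases i) (simp_all del: upt_Suc)
    have v0: "v (2 + 2 * j) = fst (a j)" for j
      by (simp add: v_def a_def outcome_def)
    have v1: "v (Suc (2 + 2 * j)) = w (map a [0..<Suc j])" for j
      unfolding y[symmetric] by (simp add: v_def outcome_def)
    have vpre: "map v [2..<k + 2] = map (outcome x y) [0..<k]" for k
      unfolding v_def by (rule outcome_prefix)
    define LI where "LI = legal_I G (\<lambda>r. (r, q) \<in> le G) ps x qs y"
    define LII where "LII = legal_II G (\<lambda>r. lessapprox G r q) ps x qs y"
    note main = play[rule_format, OF v0 v1]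
    have adm: "opponent_legal q Q 2 a v j" if "LI j" for j
    proof -
      have "map v [2..<Suc (2 + 2 * j)] = map (outcome x y) [0..<2 * j + 1]"
        using vpre[of "2 * j + 1"] by simp
      then show ?thesis
        using that ps[of j] by (simp add: LI_def legal_I_def opponent_legal_def a_def del: upt_Suc)
    qed
    have step: "LII i" if "\<forall>j<i. LI j" for i
    proof -
      have *: "\<forall>j<i. opponent_legal q Q 2 a v j" using that adm by simp
      have "lessapprox G (ps i) q"
        using main[THEN conjunct1, rule_format, of i] * ps by simp
      moreover have "y (i - 1) \<in> Xset G \<and> (map (outcome x y) [0..<2 * i], qs (i - 1)) \<in> tri G" if "i > 0"
      proof -
        have "y (i - 1) \<in> Xset G"
          using main[THEN conjunct1, rule_format, of i] * y[of "i - 1"] that by simp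
        moreover have "(map v [2..<2 + 2 * i], snd (a (i - 1))) \<in> tri G"
        proof -
          have "\<forall>j. i = Suc j \<longrightarrow> (map v [2..<2 + 2 * i], snd (a j)) \<in> tri G"
            using main[THEN conjunct1, rule_format, of i] * by blast
          from this[rule_format, of "i - 1"] show ?thesis using that by (simp del: upt_Suc)
        qed
        moreover have "map v [2..<2 + 2 * i] = map (outcome x y) [0..<2 * i]"
          using vpre[of "2 * i"] by (simp add: add.commute)
        ultimately show ?thesis by (simp add: a_def)
      qed
      ultimately show ?thesis
        using gowers_le_carrier[OF G] unfolding LII_def legal_II_def lessapprox_def by auto
    qed
    show ?thesis
    proof (cases "\<forall>i. LI i")
      case True
      have "(\<lambda>n. v (n + 2)) \<in> Y" by (rule main[THEN conjunct2, rule_format], rule adm, rule True[rule_format])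
      then have "outcome x y \<in> Y" by (simp add: v_def)
      then show ?thesis
        using True step unfolding wins_II_def LI_def[symmetric] LII_def[symmetric] by simp
    next
      case False
      define i where "i = (LEAST i. \<not> LI i)"
      have "\<not> LI i" "\<forall>j<i. LI j"
        unfolding i_def using False LeastI_ex[of "\<lambda>i. \<not> LI i"] not_less_Least by blast+
      then show ?thesis
        using step unfolding wins_II_def LI_def[symmetric] LII_def[symmetric]
        by (intro disjI1 exI[of _ i]) simp
    qed
  qed
  then have "II_reaches_in_B G q Y"
    unfolding II_reaches_in_B_def II_can_reach_def by (intro exI[of _ "Q []"] exI[of _ \<tau>]) simp
  then show ?thesis using qp gowers_le_carrier[OF G qp] by blast
qed

text \<open>
  The set of runs won by I, with the union and the intersection displayed that show membership in a
  suitable class.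
\<close>

definition payoff :: "(nat \<Rightarrow> 'x) set \<Rightarrow> (nat \<Rightarrow> 'm) set" where
  "payoff Y = {z. \<exists>n. odd n \<and> \<not> legal_at z n \<and> (\<forall>m<n. legal_at z m)} \<union>
     {z. \<forall>n. legal_at z n} \<inter> (\<lambda>z n. \<alpha> (z (n + 2))) -` Y"

lemma payoff_iff:
  "z \<in> payoff Y \<longleftrightarrow> (\<exists>n. odd n \<and> \<not> legal_at z n \<and> (\<forall>m<n. legal_at z m)) \<or>
     ((\<forall>n. legal_at z n) \<and> (\<lambda>n. \<alpha> (z (n + 2))) \<in> Y)"
  unfolding payoff_def by (simp only: Un_iff Int_iff mem_Collect_eq vimage_eq)

lemma winning_first:
  assumes "\<And>z. follows True \<sigma> z \<Longrightarrow> z \<in> payoff Y"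
  shows "winning True \<sigma> Y"
  unfolding winning_def
proof (intro allI impI conjI)
  fix z assume z: "follows True \<sigma> z"
  have pay: "z \<in> payoff Y" by (rule assms[OF z])
  show "legal_at z n" if "even n = True" "\<forall>m<n. legal_at z m" for n
  \<comment> \<open>If II breaks a rule first, it is later than \<open>n\<close>.\<close>
  proof (cases "\<exists>k. odd k \<and> \<not> legal_at z k \<and> (\<forall>m<k. legal_at z m)")
    case True
    then obtain k where k: "odd k" "\<not> legal_at z k" "\<forall>m<k. legal_at z m" by (elim exE conjE)
    have "n < k"
    proof (rule linorder_cases[of n k])
      show "n = k \<Longrightarrow> n < k" using k(1) that(1) by auto
      show "k < n \<Longrightarrow> n < k" using k(2) that(2) by auto
    qed
    then show ?thesis using k(3) by simp
  next
    case False
    then have "\<forall>n. legal_at z n" using pay unfolding payoff_iff by (elim disjE conjE) (erule notE)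
    then show ?thesis by (rule spec)
  qed
  show "(\<lambda>n. \<alpha> (z (n + 2))) \<in> Y" if "\<forall>n. legal_at z n"
    using pay that unfolding payoff_iff by (elim disjE exE conjE) simp_all
qed

lemma winning_second:
  assumes "\<And>z. follows False \<sigma> z \<Longrightarrow> z \<notin> payoff Y"
  shows "winning False \<sigma> (topspace (X_omega G) - Y)"
  unfolding winning_def
proof (intro allI impI conjI)
  fix z assume z: "follows False \<sigma> z"
  have pay: "z \<notin> payoff Y" by (rule assms[OF z])
  show "legal_at z n" if "even n = False" "\<forall>m<n. legal_at z m" for n
  proof (rule ccontr)
    assume "\<not> legal_at z n"
    then have "odd n \<and> \<not> legal_at z n \<and> (\<forall>m<n. legal_at z m)" using that by simp
    then show False using pay unfolding payoff_iff by (elim notE) (intro disjI1 exI)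
  qed
  show "(\<lambda>n. \<alpha> (z (n + 2))) \<in> topspace (X_omega G) - Y" if "\<forall>n. legal_at z n"
  proof
    show "(\<lambda>n. \<alpha> (z (n + 2))) \<in> topspace (X_omega G)" by (auto simp: \<alpha>_in)
    show "(\<lambda>n. \<alpha> (z (n + 2))) \<notin> Y" using pay that unfolding payoff_iff by simp
  qed
qed

end

section \<open>Borel maps into second countable spaces\<close>

text \<open>
  An open set is a countable union of basic sets, so basic sets suffice.
\<close>

lemma measurable_into_borel_alg:
  assumes f: "f \<in> space M \<rightarrow> topspace T"
    and base: "countable \<B>" "\<And>U x. openin T U \<Longrightarrow> x \<in> U \<Longrightarrow> \<exists>V\<in>\<B>. x \<in> V \<and> V \<subseteq> U"
    and pre: "\<And>V. V \<in> \<B> \<Longrightarrow> f -` V \<inter> space M \<in> sets M"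
  shows "f \<in> M \<rightarrow>\<^sub>M borel_alg T"
  unfolding borel_alg_def
proof (rule measurable_measure_of)
  show "{U. openin T U} \<subseteq> Pow (topspace T)"
    using openin_subset by blast
  show "f -` U \<inter> space M \<in> sets M" if "U \<in> {U. openin T U}" for U
  proof -
    have "U = \<Union>{V\<in>\<B>. V \<subseteq> U}"
      using base(2)[of U] that by blast
    then have "f -` U \<inter> space M = (\<Union>V\<in>{V\<in>\<B>. V \<subseteq> U}. f -` V \<inter> space M)"
      by blast
    moreover have "countable {V\<in>\<B>. V \<subseteq> U}"
      using base(1) by simp
    ultimately show ?thesis
      by (simp only:) (rule sets.countable_UN'', auto intro: pre)
  qed
qed (rule f)

lemma openin_in_borel_alg: "openin T U \<Longrightarrow> U \<in> sets (borel_alg T)"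
  unfolding borel_alg_def by (simp add: Pow_def subset_iff openin_subset[THEN subsetD] sigma_sets.Basic)

text \<open>
  With countable bases, the Borel sets of a product are generated by rectangles; without them they
  need not be.  This is what turns \<open>\<le>\<close> and \<open>\<lhd>\<close> into Borel conditions on pairs of Borel functions.
\<close>

lemma measurable_pair_borel_alg:
  assumes f: "f \<in> M \<rightarrow>\<^sub>M borel_alg S" and g: "g \<in> M \<rightarrow>\<^sub>M borel_alg T"
    and "second_countable S" "second_countable T"
  shows "(\<lambda>z. (f z, g z)) \<in> M \<rightarrow>\<^sub>M borel_alg (prod_topology S T)"
proof -
  obtain \<B> where "countable \<B>" and opB: "\<forall>V\<in>\<B>. openin S V"
      and baB: "\<forall>U x. openin S U \<and> x \<in> U \<longrightarrow> (\<exists>V\<in>\<B>. x \<in> V \<and> V \<subseteq> U)"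
    using assms(3) unfolding second_countable_def by (elim exE conjE)
  note B = this(1) opB[rule_format] baB[rule_format, OF conjI]
  obtain \<C> where "countable \<C>" and opC: "\<forall>V\<in>\<C>. openin T V"
      and baC: "\<forall>U x. openin T U \<and> x \<in> U \<longrightarrow> (\<exists>V\<in>\<C>. x \<in> V \<and> V \<subseteq> U)"
    using assms(4) unfolding second_countable_def by (elim exE conjE)
  note C = this(1) opC[rule_format] baC[rule_format, OF conjI]
  show ?thesis
  proof (rule measurable_into_borel_alg[where \<B> = "(\<lambda>(V, W). V \<times> W) ` (\<B> \<times> \<C>)"])
    show "(\<lambda>z. (f z, g z)) \<in> space M \<rightarrow> topspace (prod_topology S T)"
      using measurable_space[OF f] measurable_space[OF g] by auto
    show "countable ((\<lambda>(V, W). V \<times> W) ` (\<B> \<times> \<C>))"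
      using B(1) C(1) by simp
    show "\<exists>V\<in>(\<lambda>(V, W). V \<times> W) ` (\<B> \<times> \<C>). z \<in> V \<and> V \<subseteq> U"
      if U: "openin (prod_topology S T) U" and z: "z \<in> U" for U z
    proof -
      have "(fst z, snd z) \<in> U" using z by simp
      then have "\<exists>V W. openin S V \<and> openin T W \<and> fst z \<in> V \<and> snd z \<in> W \<and> V \<times> W \<subseteq> U"
        by (rule iffD1[OF openin_prod_topology_alt U, rule_format])
      then obtain V W where VW: "openin S V" "openin T W" "fst z \<in> V" "snd z \<in> W" "V \<times> W \<subseteq> U"
        by (elim exE conjE)
      obtain V' where V': "V' \<in> \<B>" "fst z \<in> V'" "V' \<subseteq> V" using B(3)[OF VW(1,3)] by blast
      obtain W' where W': "W' \<in> \<C>" "snd z \<in> W'" "W' \<subseteq> W" using C(3)[OF VW(2,4)] by blast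
      have "z \<in> V' \<times> W'" "V' \<times> W' \<subseteq> U"
        using V' W' VW(5) by (auto simp: mem_Times_iff)
      moreover have "V' \<times> W' \<in> (\<lambda>(V, W). V \<times> W) ` (\<B> \<times> \<C>)"
        using V'(1) W'(1) by (intro image_eqI[of _ _ "(V', W')"]) auto
      ultimately show ?thesis by (intro bexI[of _ "V' \<times> W'"] conjI)
    qed
    fix R assume "R \<in> (\<lambda>(V, W). V \<times> W) ` (\<B> \<times> \<C>)"
    then obtain V W where R: "R = V \<times> W" "V \<in> \<B>" "W \<in> \<C>" by auto
    have "(\<lambda>z. (f z, g z)) -` R \<inter> space M = (f -` V \<inter> space M) \<inter> (g -` W \<inter> space M)"
      unfolding R(1) by auto
    also have "\<dots> \<in> sets M"
      using measurable_sets[OF f openin_in_borel_alg[OF B(2)[OF R(2)]]]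
        measurable_sets[OF g openin_in_borel_alg[OF C(2)[OF R(3)]]] by (rule sets.Int)
    finally show "(\<lambda>z. (f z, g z)) -` R \<inter> space M \<in> sets M" .
  qed
qed

lemma measurable_discrete_borel_alg:
  assumes "countable X" and f: "f \<in> M \<rightarrow>\<^sub>M count_space X"
  shows "f \<in> M \<rightarrow>\<^sub>M borel_alg (discrete_topology X)"
proof (rule measurable_into_borel_alg[where \<B> = "(\<lambda>x. {x}) ` X"])
  show "f \<in> space M \<rightarrow> topspace (discrete_topology X)"
    using measurable_space[OF f] by auto
  show "f -` V \<inter> space M \<in> sets M" if V: "V \<in> (\<lambda>x. {x}) ` X" for V
  proof (rule measurable_sets[OF f])
    show "V \<in> sets (count_space X)" using V by auto
  qed
  show "\<exists>V\<in>(\<lambda>x. {x}) ` X. x \<in> V \<and> V \<subseteq> U" if "openin (discrete_topology X) U" "x \<in> U" for U x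
    using that by (intro bexI[of _ "{x}"]) auto
  show "countable ((\<lambda>x. {x}) ` X)" using assms(1) by simp
qed

lemma polish_imp_second_countable:
  assumes "polish_topology T"
  shows "second_countable T"
proof -
  obtain M d where M: "Metric_space M d" and T: "T = Metric_space.mtopology M d"
    using assms unfolding polish_topology_def completely_metrizable_space_def by blast
  interpret Metric_space M d by (rule M)
  obtain C where C: "countable C" "C \<subseteq> M" "mtopology closure_of C = M"
    using assms T unfolding polish_topology_def separable_space_def by auto
  define B where "B = (\<lambda>(c, n). mball c (1 / Suc n)) ` (C \<times> (UNIV :: nat set))"
  show ?thesis
    unfolding second_countable_def
  proof (intro exI[of _ B] conjI allI impI ballI)
    show "countable B" unfolding B_def using C(1) by simp
    show "openin T V" if "V \<in> B" for V using that unfolding B_def T by auto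
    fix U x assume Ux: "openin T U \<and> x \<in> U"
    then obtain r where r: "r > 0" "mball x r \<subseteq> U" and xM: "x \<in> M"
      unfolding T openin_mtopology by blast
    obtain n where n: "2 / Suc n < r"
    proof -
      obtain n where "inverse (Suc n) < r / 2" using reals_Archimedean[of "r/2"] r(1) by auto
      then have "2 / Suc n < r" by (simp add: field_simps)
      then show thesis by (rule that)
    qed
    have "x \<in> mtopology closure_of C" using C(3) xM by simp
    then obtain c where c: "c \<in> C" "c \<in> mball x (1 / Suc n)"
      unfolding metric_closure_of by (auto dest!: spec[of _ "1 / real (Suc n)"])
    have "mball c (1 / Suc n) \<subseteq> mball x r"
    proof
      fix y assume y: "y \<in> mball c (1 / Suc n)"
      have "d x y \<le> d x c + d c y" using y c(2) by (auto intro: triangle)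
      also have "\<dots> < 1 / Suc n + 1 / Suc n" using y c(2) by auto
      also have "\<dots> < r" using n by simp
      finally show "y \<in> mball x r" using y xM by simp
    qed
    moreover have "x \<in> mball c (1 / Suc n)" using c by (auto simp: commute)
    ultimately show "\<exists>V\<in>B. x \<in> V \<and> V \<subseteq> U"
      using c(1) r(2) unfolding B_def by (intro bexI[of _ "mball c (1 / Suc n)"]) auto
  qed
qed

lemma list_of_measurable_letters:
  assumes X: "countable X" and F: "\<And>k. F k \<in> M \<rightarrow>\<^sub>M count_space X"
  shows "(\<lambda>z. map (\<lambda>k. F k z) ns) \<in> M \<rightarrow>\<^sub>M count_space (lists X)"
proof -
  have Fin: "F k z \<in> X" if "z \<in> space M" for k z
    using measurable_space[OF F that] by simp
  have "(\<lambda>z. map (\<lambda>k. F k z) ns) -` {s} \<inter> space M \<in> sets M" for s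
  proof (induction ns arbitrary: s)
    case Nil
    then show ?case by (cases s) auto
  next
    case (Cons n ns)
    show ?case
    proof (cases s)
      case Nil then show ?thesis by (simp add: vimage_def)
    next
      case (Cons x s')
      have "F n -` ({x} \<inter> X) \<inter> space M \<in> sets M"
        by (rule measurable_sets[OF F]) simp
      moreover have "(\<lambda>z. map (\<lambda>k. F k z) (n # ns)) -` {s} \<inter> space M =
          (F n -` ({x} \<inter> X) \<inter> space M) \<inter> ((\<lambda>z. map (\<lambda>k. F k z) ns) -` {s'} \<inter> space M)"
        using Fin unfolding Cons by auto
      ultimately show ?thesis using Cons.IH[of s'] by simp
    qed
  qed
  moreover have "countable (lists X)" using X by simp
  ultimately show ?thesis
    by (subst measurable_count_space_eq_countable) (auto simp: Fin)
qed

text \<open>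
  The cylinders fixed by finite words form a countable base of \<open>X\<^sup>\<omega>\<close>, and finite words of
  measurable letters are measurable.
\<close>

lemma measurable_into_discrete_omega:
  assumes X: "countable X" and F: "\<And>k. F k \<in> M \<rightarrow>\<^sub>M count_space X"
  shows "(\<lambda>z (k::nat). F k z) \<in> M \<rightarrow>\<^sub>M borel_alg (product_topology (\<lambda>_. discrete_topology X) UNIV)"
    (is "?F \<in> M \<rightarrow>\<^sub>M borel_alg ?T")
proof -
  define cyl where "cyl s = {f \<in> topspace ?T. map f [0..<length s] = s}" for s
  have Fin: "F k z \<in> X" if "z \<in> space M" for k z
    using measurable_space[OF F that] by simp
  show ?thesis
  proof (rule measurable_into_borel_alg[where \<B> = "cyl ` lists X"])
    show "?F \<in> space M \<rightarrow> topspace ?T" using Fin by auto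
    show "countable (cyl ` lists X)"
      using X by simp
    show "\<exists>V\<in>cyl ` lists X. x \<in> V \<and> V \<subseteq> U"
      if U: "openin ?T U" "x \<in> U" for U x
    proof -
      obtain V where V: "finite {i. V i \<noteq> topspace (discrete_topology X)}"
          "x \<in> Pi\<^sub>E UNIV V" "Pi\<^sub>E UNIV V \<subseteq> U"
        using product_topology_open_contains_basis[OF U] by auto
      \<comment> \<open>Basic open sets restrict coordinates below some \<open>N\<close> only.\<close>
      obtain N where N: "\<And>i. V i \<noteq> X \<Longrightarrow> i < N"
        using V(1) unfolding finite_nat_set_iff_bounded by auto
      have xT: "x \<in> topspace ?T" using U openin_subset by blast
      have "f \<in> Pi\<^sub>E UNIV V" if "f \<in> cyl (map x [0..<N])" for f
      proof (rule PiE_I)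
        have f: "f \<in> topspace ?T" "map f [0..<N] = map x [0..<N]"
          using that by (simp_all add: cyl_def)
        fix i
        show "f i \<in> V i"
        proof (cases "i < N")
          case True
          then have "f i = x i" using f(2) by simp
          then show ?thesis using V(2) by auto
        next
          case False
          then have "V i = X" using N by blast
          then show ?thesis using f(1) by auto
        qed
      qed simp
      then have "cyl (map x [0..<N]) \<subseteq> U" using V(3) by blast
      moreover have "x \<in> cyl (map x [0..<N])" using xT by (simp add: cyl_def)
      moreover have "map x [0..<N] \<in> lists X" using xT by (auto simp: PiE_iff)
      ultimately show ?thesis
        by (intro bexI[of _ "cyl (map x [0..<N])"] conjI imageI)
    qed
    fix V assume "V \<in> cyl ` lists X"
    then obtain s where s: "s \<in> lists X" "V = cyl s" by blast
    have "(\<lambda>z. map (\<lambda>k. F k z) [0..<length s]) -` {s} \<inter> space M \<in> sets M"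
      by (rule measurable_sets[OF list_of_measurable_letters[OF X, where F = F]]) (use F s in simp_all)
    moreover have "?F -` V \<inter> space M = (\<lambda>z. map (\<lambda>k. F k z) [0..<length s]) -` {s} \<inter> space M"
      unfolding s(2) cyl_def using Fin by auto
    ultimately show "?F -` V \<inter> space M \<in> sets M" by simp
  qed
qed

section \<open>Coding points and subspaces by real numbers\<close>

text \<open>
  A sequence \<open>b\<close> is coded by the ternary expansion that has the digit 1 at the positions
  \<open>prod_encode (n, b n)\<close> and 0 elsewhere.  Avoiding the digit 2 keeps each tail of the expansion at most a half, so
  that the digits are recovered by iterating the map \<open>u \<mapsto> frac (3 u)\<close>; this and the search for
  the first nonzero digit are Borel on all reals.
\<close>

lemma real_codes_nat_sequences:
  shows "\<exists>a :: real \<Rightarrow> nat \<Rightarrow> nat. (\<forall>n. (\<lambda>r. a r n) \<in> borel \<rightarrow>\<^sub>M count_space UNIV) \<and> surj a"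
proof -
  \<comment> \<open>Digit \<open>k\<close> of \<open>r\<close> counts as 1 if \<open>3 * dig r k\<close> is at least 1.\<close>
  define dig :: "real \<Rightarrow> nat \<Rightarrow> real" where "dig r k = ((\<lambda>u. frac (3 * u)) ^^ k) r" for r k
  define a where "a r n = (LEAST m. 1 \<le> 3 * dig r (prod_encode (n, m)))" for r n
  have frac_meas: "(frac :: real \<Rightarrow> real) \<in> borel_measurable borel"
    unfolding frac_def by measurable
  have dig_meas: "(\<lambda>r. dig r k) \<in> borel_measurable borel" for k
  proof (induction k)
    case 0 show ?case by (simp add: dig_def)
  next
    case (Suc k)
    have "(\<lambda>r. dig r (Suc k)) = (\<lambda>r. frac (3 * dig r k))" by (simp add: dig_def)
    then show ?case using measurable_compose[OF _ frac_meas, of "\<lambda>r. 3 * dig r k" borel] Suc by simp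
  qed
  have "(\<lambda>r. a r n) \<in> borel \<rightarrow>\<^sub>M count_space UNIV" for n
    unfolding a_def using dig_meas by measurable
  moreover have "\<exists>r. a r = b" for b
  proof -
    define c :: "nat \<Rightarrow> real" where "c k = (if snd (prod_decode k) = b (fst (prod_decode k)) then 1 else 0)" for k
    \<comment> \<open>The tails of the expansion of the code of \<open>b\<close>; the code itself is \<open>u 0\<close>.\<close>
    define u where "u k = (\<Sum>j. c (k + j) / 3 ^ Suc j)" for k
    have geo: "(\<lambda>j. 1 / (3::real) ^ Suc j) sums (1 / 2)"
      using sums_mult[OF geometric_sums[of "1/3::real"], of "1/3"] by (simp add: power_divide)
    have summ: "summable (\<lambda>j. c (k + j) / 3 ^ Suc j)" for k
      by (rule summable_comparison_test[OF _ sums_summable[OF geo]]) (auto simp: c_def intro!: exI[of _ 0])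
    have u0: "0 \<le> u k" for k
      unfolding u_def by (rule suminf_nonneg[OF summ]) (simp add: c_def)
    have u1: "u k \<le> 1 / 2" for k
      unfolding u_def sums_unique[OF geo]
      by (rule suminf_le[OF _ summ sums_summable[OF geo]]) (simp add: c_def)
    have step: "3 * u k = c k + u (Suc k)" for k
    proof -
      have "u k = c k / 3 + (\<Sum>j. c (k + Suc j) / 3 ^ Suc (Suc j))"
        unfolding u_def using suminf_split_head[OF summ[of k]] by simp
      also have "(\<Sum>j. c (k + Suc j) / 3 ^ Suc (Suc j)) = (\<Sum>j. (c (Suc k + j) / 3 ^ Suc j) * (1/3))"
        by (rule suminf_cong) simp
      also have "\<dots> = u (Suc k) * (1/3)"
        unfolding u_def by (rule suminf_mult2[symmetric, OF summ])
      finally show ?thesis by simp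
    qed
    have frac: "frac (3 * u k) = u (Suc k)" for k
      unfolding step frac_unique_iff using u0[of "Suc k"] u1[of "Suc k"]
      by (auto simp: c_def)
    have dig: "dig (u 0) k = u k" for k
      by (induction k) (simp_all add: dig_def frac)
    have one: "1 \<le> 3 * u k \<longleftrightarrow> c k = 1" for k
      unfolding step using u0[of "Suc k"] u1[of "Suc k"] by (auto simp: c_def)
    have "a (u 0) n = b n" for n
      unfolding a_def dig one by (auto simp: c_def intro!: Least_equality split: if_splits)
    then show ?thesis by blast
  qed
  then have "surj a" unfolding surj_def by metis
  ultimately show ?thesis by (intro exI[of _ a]) simp
qed

text \<open>
  Decode \<open>b\<close> as the sequence of points \<open>e (b n)\<close> from a dense sequence \<open>e\<close>, and map \<open>b\<close> to the limit
  if consecutive distances are at most \<open>2\<^bsup>-n\<^esup>\<close>, to \<open>e 0\<close> otherwise.  By completeness the limit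
  exists, and by density each point is one.  Since the limit is within \<open>2 \<cdot> 2\<^bsup>-n\<^esup>\<close> of
  \<open>e (b n)\<close>, membership in an open set is decided by a single entry of \<open>b\<close>.
\<close>

lemma polish_borel_image_of_nat_sequences:
  assumes pol: "polish_topology T" and ne: "topspace T \<noteq> {}"
  shows "\<exists>g :: (nat \<Rightarrow> nat) \<Rightarrow> 'a. range g = topspace T \<and>
    (\<forall>(M :: real measure) a. (\<forall>n. (\<lambda>r. a r n) \<in> M \<rightarrow>\<^sub>M count_space UNIV) \<longrightarrow>
      (\<lambda>r. g (a r)) \<in> M \<rightarrow>\<^sub>M borel_alg T)"
proof -
  obtain M d where M: "Metric_space M d" and comp: "Metric_space.mcomplete M d"
    and T: "T = Metric_space.mtopology M d"
    using pol unfolding polish_topology_def completely_metrizable_space_def by blast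
  interpret Metric_space M d by (rule M)
  obtain C where C: "countable C" "C \<subseteq> M" "mtopology closure_of C = M"
    using pol T unfolding polish_topology_def separable_space_def by auto
  have Cne: "C \<noteq> {}" using C(3) ne T by auto
  define e where "e = from_nat_into C"
  have eM: "e i \<in> M" for i unfolding e_def using from_nat_into[OF Cne] C(2) by blast
  define good where "good b \<longleftrightarrow> (\<forall>n. d (e (b n)) (e (b (Suc n))) \<le> (1/2) ^ n)" for b
  define g where "g b = (if good b then SOME l. limitin mtopology (\<lambda>n. e (b n)) l sequentially else e 0)" for b
  have close: "d (e (b n)) (e (b (n + k))) \<le> 2 * (1/2) ^ n - 2 * (1/2) ^ (n + k)" if "good b" for b n k
  proof (induction k)
    case 0 show ?case using eM by simp
  next
    case (Suc k)
    have "d (e (b n)) (e (b (n + Suc k))) \<le> d (e (b n)) (e (b (n + k))) + d (e (b (n + k))) (e (b (Suc (n + k))))"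
      using triangle eM by simp
    also have "\<dots> \<le> 2 * (1/2) ^ n - 2 * (1/2) ^ (n + k) + (1/2) ^ (n + k)"
      using Suc that unfolding good_def by (meson add_mono)
    finally show ?case by (simp add: field_simps)
  qed
  have lim: "limitin mtopology (\<lambda>n. e (b n)) (g b) sequentially" if "good b" for b
  proof -
    have "MCauchy (\<lambda>n. e (b n))"
      unfolding MCauchy_def
    proof (intro conjI allI impI)
      show "range (\<lambda>n. e (b n)) \<subseteq> M" using eM by blast
      fix \<epsilon> :: real assume "\<epsilon> > 0"
      then obtain N where N: "(1/2::real) ^ N < \<epsilon> / 4"
        using real_arch_pow_inv[of "\<epsilon>/4" "1/2"] by auto
      have "d (e (b n)) (e (b n')) < \<epsilon>" if "N \<le> n" "N \<le> n'" for n n'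
      proof -
        have *: "d (e (b N)) (e (b m)) \<le> 2 * (1/2) ^ N" if "N \<le> m" for m
          using close[OF \<open>good b\<close>, of N "m - N"] that
          by (smt (verit) le_add_diff_inverse zero_le_power divide_nonneg_nonneg)
        have "d (e (b n)) (e (b n')) \<le> d (e (b N)) (e (b n)) + d (e (b N)) (e (b n'))"
          using triangle[OF eM[of "b n"] eM[of "b N"] eM[of "b n'"]] by (simp add: commute)
        then show ?thesis using *[OF that(1)] *[OF that(2)] N by simp
      qed
      then show "\<exists>N. \<forall>n n'. N \<le> n \<longrightarrow> N \<le> n' \<longrightarrow> d (e (b n)) (e (b n')) < \<epsilon>" by blast
    qed
    then obtain l where "limitin mtopology (\<lambda>n. e (b n)) l sequentially"
      using comp unfolding mcomplete_def by blast
    then have "\<exists>l. limitin mtopology (\<lambda>n. e (b n)) l sequentially" by blast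
    from someI_ex[OF this] show ?thesis
      using that by (simp add: g_def)
  qed
  have gM: "g b \<in> M" for b
    using lim[of b] eM unfolding limit_metric_sequentially by (cases "good b") (auto simp: g_def)
  have near: "d (e (b n)) (g b) \<le> 2 * (1/2) ^ n" if gb: "good b" for b n
  proof (rule field_le_epsilon)
    fix \<epsilon> :: real assume "\<epsilon> > 0"
    then obtain N where N: "\<And>m. m \<ge> N \<Longrightarrow> d (e (b m)) (g b) < \<epsilon>"
      using lim[OF gb] unfolding limit_metric_sequentially by blast
    have "d (e (b n)) (g b) \<le> d (e (b n)) (e (b (n + N))) + d (e (b (n + N))) (g b)"
      using triangle[OF eM eM gM] by blast
    also have "\<dots> \<le> 2 * (1/2) ^ n + \<epsilon>"
      using close[OF gb, of n N] N[of "n + N"] zero_le_power[of "1/2::real" "n + N"] by linarith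
    finally show "d (e (b n)) (g b) \<le> 2 * (1/2) ^ n + \<epsilon>" .
  qed
  have "\<exists>b. g b = x" if x: "x \<in> M" for x
  proof -
    have "\<exists>i. d (e i) x < (1/2) ^ Suc (Suc n)" for n
    proof -
      have "x \<in> mtopology closure_of C" using C(3) x by simp
      moreover have "(0::real) < (1/2) ^ Suc (Suc n)" by simp
      ultimately obtain c where c: "c \<in> C" "c \<in> mball x ((1/2) ^ Suc (Suc n))"
        unfolding metric_closure_of by blast
      have "e (to_nat_on C c) = c" unfolding e_def using c(1) C(1) by simp
      then show ?thesis using c(2) by (metis commute in_mball)
    qed
    then obtain b where b: "\<And>n. d (e (b n)) x < (1/2) ^ Suc (Suc n)" by metis
    have "good b"
      unfolding good_def
    proof
      fix n
      have "d (e (b n)) (e (b (Suc n))) \<le> d (e (b n)) x + d (e (b (Suc n))) x"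
        using triangle[OF eM[of "b n"] x eM[of "b (Suc n)"]] by (simp add: commute)
      also have "\<dots> \<le> (1/2) ^ n"
        using b[of n] b[of "Suc n"] zero_le_power[of "1/2::real" n] by (simp add: field_simps)
      finally show "d (e (b n)) (e (b (Suc n))) \<le> (1/2) ^ n" .
    qed
    have "limitin mtopology (\<lambda>n. e (b n)) x sequentially"
      unfolding limit_metric_sequentially
    proof (intro conjI allI impI)
      fix \<epsilon> :: real assume "\<epsilon> > 0"
      then obtain N where N: "(1/2::real) ^ N < \<epsilon>"
        using real_arch_pow_inv[of "\<epsilon>" "1/2"] by auto
      have "d (e (b n)) x < \<epsilon>" if "n \<ge> N" for n
      proof -
        have "(1/2::real) ^ Suc (Suc n) \<le> (1/2) ^ N"
          by (rule power_decreasing) (use that in auto)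
        then show ?thesis using b[of n] N by linarith
      qed
      then show "\<exists>N. \<forall>n\<ge>N. e (b n) \<in> M \<and> d (e (b n)) x < \<epsilon>" using eM by blast
    qed (rule x)
    then have "x = g b"
      using lim[OF \<open>good b\<close>] limitin_metric_unique trivial_limit_sequentially by blast
    then show ?thesis by blast
  qed
  then have "range g = topspace T"
    using gM T by auto
  moreover have "(\<lambda>r. g (a r)) \<in> N \<rightarrow>\<^sub>M borel_alg T"
    if a[measurable]: "\<And>n. (\<lambda>r. a r n) \<in> N \<rightarrow>\<^sub>M count_space UNIV" for a and N :: "real measure"
    unfolding borel_alg_def
  proof (rule measurable_measure_of)
    show "{U. openin T U} \<subseteq> Pow (topspace T)"
      using openin_subset by blast
    show "(\<lambda>r. g (a r)) \<in> space N \<rightarrow> topspace T"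
      using gM T by auto
    fix U assume "U \<in> {U. openin T U}"
    then have U: "openin mtopology U" using T by simp
    have inU: "g b \<in> U \<longleftrightarrow> (\<exists>n. mcball (e (b n)) (2 * (1/2) ^ n) \<subseteq> U)" if "good b" for b
    proof
      assume "g b \<in> U"
      then obtain \<epsilon> where \<epsilon>: "\<epsilon> > 0" "mball (g b) \<epsilon> \<subseteq> U"
        using U unfolding openin_mtopology by blast
      then obtain n where n: "(1/2::real) ^ n < \<epsilon> / 4"
        using real_arch_pow_inv[of "\<epsilon>/4" "1/2"] by auto
      have "mcball (e (b n)) (2 * (1/2) ^ n) \<subseteq> mball (g b) \<epsilon>"
      proof
        fix y assume y: "y \<in> mcball (e (b n)) (2 * (1/2) ^ n)"
        have "d (g b) y \<le> d (e (b n)) (g b) + d (e (b n)) y"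
          using triangle[OF gM[of b] eM[of "b n"], of y] y by (simp add: commute)
        then have "d (g b) y < \<epsilon>" using near[OF that, of n] y n by simp
        then show "y \<in> mball (g b) \<epsilon>" using y gM by simp
      qed
      then show "\<exists>n. mcball (e (b n)) (2 * (1/2) ^ n) \<subseteq> U" using \<epsilon>(2) by blast
    next
      assume "\<exists>n. mcball (e (b n)) (2 * (1/2) ^ n) \<subseteq> U"
      then show "g b \<in> U" using near[OF that] eM gM by (auto simp: subset_iff)
    qed
    have eq: "g b \<in> U \<longleftrightarrow>
        (if good b then \<exists>n. mcball (e (b n)) (2 * (1/2) ^ n) \<subseteq> U else e 0 \<in> U)" for b
      using inU[of b] by (simp add: g_def)
    have [measurable]: "Measurable.pred N (\<lambda>r. mcball (e (a r n)) (2 * (1/2) ^ n) \<subseteq> U)" for n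
      using measurable_compose[OF a, of "\<lambda>i. mcball (e i) (2 * (1/2) ^ n) \<subseteq> U" "count_space UNIV" n] by simp
    have "Measurable.pred N (\<lambda>r. \<exists>i j. a r n = i \<and> a r (Suc n) = j \<and> d (e i) (e j) \<le> (1/2) ^ n)" for n
      by measurable
    then have [measurable]: "Measurable.pred N (\<lambda>r. d (e (a r n)) (e (a r (Suc n))) \<le> (1/2) ^ n)" for n
      by simp
    have "{r \<in> space N. if \<forall>n. d (e (a r n)) (e (a r (Suc n))) \<le> (1/2) ^ n
        then \<exists>n. mcball (e (a r n)) (2 * (1/2) ^ n) \<subseteq> U else e 0 \<in> U} \<in> sets N"
      by (cases "e 0 \<in> U") (simp_all only: if_True if_False, measurable)
    then show "(\<lambda>r. g (a r)) -` U \<inter> space N \<in> sets N"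
      by (simp add: vimage_def Int_def eq good_def conj_commute cong: conj_cong)
  qed
  ultimately show ?thesis by (intro exI[of _ g]) simp
qed

text \<open>
  The first entry of the coded sequence of natural numbers gives a point; the remaining ones give an
  element of a Polish space that is mapped continuously onto \<open>P\<close>.
\<close>

lemma analytic_gowers_space_coding:
  assumes G: "gowers_space G" and P: "analytic_in T (Pset G)" "Pset G \<subseteq> topspace T"
  obtains \<alpha> :: "real \<Rightarrow> 'x" and \<rho> :: "real \<Rightarrow> 'p"
  where "range (\<lambda>r. (\<alpha> r, \<rho> r)) = Xset G \<times> Pset G"
    "\<alpha> \<in> borel \<rightarrow>\<^sub>M count_space (Xset G)" "\<rho> \<in> borel \<rightarrow>\<^sub>M borel_alg (subtopology T (Pset G))"
proof -
  obtain S :: "univ topology" and f where S: "polish_topology S" and f: "continuous_map S T f"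
      and fP: "f ` topspace S = Pset G"
    using P(1) unfolding analytic_in_def by (elim exE conjE)
  have "Pset G \<noteq> {}" using G by (simp add: gowers_space_def)
  then have "topspace S \<noteq> {}" using fP by blast
  from polish_borel_image_of_nat_sequences[OF S this] obtain g :: "(nat \<Rightarrow> nat) \<Rightarrow> univ" where g: "range g = topspace S"
    and gm: "\<forall>(M :: real measure) a. (\<forall>n. (\<lambda>r. a r n) \<in> M \<rightarrow>\<^sub>M count_space UNIV) \<longrightarrow>
      (\<lambda>r. g (a r)) \<in> M \<rightarrow>\<^sub>M borel_alg S"
    by (elim exE conjE)
  obtain a :: "real \<Rightarrow> nat \<Rightarrow> nat" where a: "\<forall>n. (\<lambda>r. a r n) \<in> borel \<rightarrow>\<^sub>M count_space UNIV" "surj a"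
    using real_codes_nat_sequences by (elim exE conjE)
  note a = a(1)[rule_format] a(2)
  define \<alpha> where "\<alpha> r = from_nat_into (Xset G) (a r 0)" for r
  define \<rho> where "\<rho> r = f (g (\<lambda>n. a r (Suc n)))" for r
  note X = gowers_X[OF G]
  show thesis
  proof (rule that[of \<alpha> \<rho>])
    show "\<alpha> \<in> borel \<rightarrow>\<^sub>M count_space (Xset G)"
      unfolding \<alpha>_def by (rule measurable_compose[OF a(1)]) (use from_nat_into[OF X(2)] in auto)
    have "continuous_map S (subtopology T (Pset G)) f"
      using f fP by (auto simp: continuous_map_in_subtopology)
    from measurable_compose[OF gm[rule_format, of "\<lambda>r n. a r (Suc n)"] continuous_map_borel_alg[OF this]]
    show "\<rho> \<in> borel \<rightarrow>\<^sub>M borel_alg (subtopology T (Pset G))"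
      unfolding \<rho>_def using a(1) by simp
    show "range (\<lambda>r. (\<alpha> r, \<rho> r)) = Xset G \<times> Pset G"
    proof (intro set_eqI iffI)
      fix u assume "u \<in> range (\<lambda>r. (\<alpha> r, \<rho> r))"
      then show "u \<in> Xset G \<times> Pset G"
        using from_nat_into[OF X(2)] g fP by (auto simp: \<alpha>_def \<rho>_def)
    next
      fix u assume "u \<in> Xset G \<times> Pset G"
      then obtain x q where u: "u = (x, q)" "x \<in> Xset G" "q \<in> Pset G" by auto
      have "q \<in> f ` range g" using u(3) fP g by simp
      then obtain b where b: "q = f (g b)" by auto
      obtain r where r: "a r = case_nat (to_nat_on (Xset G) x) b"
        using a(2) unfolding surj_def by metis
      have "\<alpha> r = x" using u(2) X(1) by (simp add: \<alpha>_def r)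
      moreover have "\<rho> r = q" by (simp add: \<rho>_def r b)
      ultimately show "u \<in> range (\<lambda>r. (\<alpha> r, \<rho> r))" using u(1) by auto
    qed
  qed
qed

section \<open>The game of Kastanas as a game on the reals\<close>

lemma borel_alg_euclidean: "borel_alg euclidean = borel"
  by (simp add: borel_alg_def borel_def)

lemma coordinate_measurable: "(\<lambda>z. z n) \<in> borel_alg real_omega \<rightarrow>\<^sub>M borel"
proof -
  have "continuous_map real_omega euclideanreal (\<lambda>z. z n)"
    by (rule continuous_map_product_projection) simp
  from continuous_map_borel_alg[OF this] show ?thesis by (simp add: borel_alg_euclidean)
qed

lemma polish_real_omega: "polish_topology real_omega"
proof -
  have "real_omega = (euclidean :: (nat \<Rightarrow> real) topology)"
    by (rule euclidean_product_topology)
  moreover have "second_countable (euclidean :: (nat \<Rightarrow> real) topology)"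
  proof -
    obtain B :: "(nat \<Rightarrow> real) set set" where B: "countable B" "topological_basis B"
      using ex_countable_basis by (elim exE conjE)
    show ?thesis
      unfolding second_countable_def
    proof (intro exI[of _ B] conjI ballI allI impI)
      show "openin euclidean V" if "V \<in> B" for V
        using topological_basis_open[OF B(2) that] by simp
      show "\<exists>V\<in>B. x \<in> V \<and> V \<subseteq> U" if "openin euclidean U \<and> x \<in> U" for U x
        by (rule topological_basisE[OF B(2), of U x]) (use that in simp_all, metis)
    qed (rule B)
  qed
  ultimately show ?thesis
    unfolding polish_topology_def
    by (simp add: completely_metrizable_space_euclidean second_countable_imp_separable_space)
qed

text \<open>
  Each rule concerns finitely many points, which are measurable, and two subspaces, which depend on
  the run in a Borel way.  Hence the first component of the union in \<open>payoff\<close> and the set of runs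
  without a broken rule are Borel; so is the map from runs to outcomes, and a suitable class contains
  the inverse image of \<open>Y\<close> under it.
\<close>

lemma payoff_in_class:
  fixes \<rho> :: "real \<Rightarrow> 'p"
  assumes \<Gamma>: "suitable \<Gamma>" and K: "kastanas_game G p \<alpha> \<rho>"
    and T: "polish_topology T" "Pset G \<subseteq> topspace T"
    and le: "le G \<in> sets (borel_alg (prod_topology (subtopology T (Pset G)) (subtopology T (Pset G))))"
    and tri: "tri G \<in> sets (borel_alg (prod_topology (discrete_topology (Seq (Xset G))) (subtopology T (Pset G))))"
    and \<alpha>: "\<alpha> \<in> borel \<rightarrow>\<^sub>M count_space (Xset G)"
    and \<rho>: "\<rho> \<in> borel \<rightarrow>\<^sub>M borel_alg (subtopology T (Pset G))"
    and Y: "class_subset \<Gamma> (X_omega G) Y"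
  shows "class_subset \<Gamma> real_omega (kastanas_game.payoff G p \<alpha> \<rho> Y)"
proof -
  interpret kastanas_game G p \<alpha> \<rho> by (rule K)
  define M where "M = borel_alg real_omega"
  let ?P = "subtopology T (Pset G)"
  have spM: "space M = UNIV" by (simp add: M_def)
  have X: "countable (Xset G)" by (rule gowers_X(1)[OF G])
  have sc: "second_countable ?P"
    by (rule second_countable_subtopology[OF polish_imp_second_countable[OF T(1)]])
  have \<alpha>z: "(\<lambda>z. \<alpha> (z n)) \<in> M \<rightarrow>\<^sub>M count_space (Xset G)" for n
    unfolding M_def by (rule measurable_compose[OF coordinate_measurable \<alpha>])
  have \<rho>z: "(\<lambda>z. \<rho> (z n)) \<in> M \<rightarrow>\<^sub>M borel_alg ?P" for n
    unfolding M_def by (rule measurable_compose[OF coordinate_measurable \<rho>])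
  have curz: "(\<lambda>z. cur (map z [0..<n])) \<in> M \<rightarrow>\<^sub>M borel_alg ?P" for n
  proof (cases "n \<le> 1")
    case True
    then show ?thesis using p T(2) by (simp add: cur_def) (auto intro!: measurable_const)
  next
    case False
    then have "(\<lambda>z. cur (map z [0..<n])) = (\<lambda>z. \<rho> (z (n - 1)))"
      by (simp add: cur_def last_map)
    then show ?thesis using \<rho>z by simp
  qed
  have le_pred: "Measurable.pred M (\<lambda>z. (\<rho> (z n), cur (map z [0..<n])) \<in> le G)" for n
    using measurable_sets[OF measurable_pair_borel_alg[OF \<rho>z curz sc sc] le]
    by (simp add: pred_def vimage_def Int_def conj_commute)
  have tri_pred: "Measurable.pred M (\<lambda>z. (map \<alpha> (drop 2 (map z [0..<Suc n])), cur (map z [0..<n])) \<in> tri G)"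
    if "2 \<le> n" for n
  proof -
    have eq: "map \<alpha> (drop 2 (map z [0..<Suc n])) = map (\<lambda>k. \<alpha> (z k)) [2..<Suc n]" for z :: "nat \<Rightarrow> real"
      by (simp add: drop_map comp_def numeral_2_eq_2 del: upt_Suc)
    have "(\<lambda>z. map (\<lambda>k. \<alpha> (z k)) [2..<Suc n]) \<in> M \<rightarrow>\<^sub>M count_space (Seq (Xset G))"
    proof -
      have *: "(\<lambda>z. map (\<lambda>k. \<alpha> (z k)) [2..<Suc n]) \<in> M \<rightarrow>\<^sub>M count_space (lists (Xset G))"
        by (rule list_of_measurable_letters[OF X, where F = "\<lambda>k z. \<alpha> (z k)"]) (rule \<alpha>z)
      have in_Seq: "map (\<lambda>k. \<alpha> (z k)) [2..<Suc n] \<in> Seq (Xset G)" for z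
        using that by (auto simp: Seq_def \<alpha>_in simp del: upt_Suc)
      show ?thesis
      proof (rule measurableI)
        show "(\<lambda>z. map (\<lambda>k. \<alpha> (z k)) [2..<Suc n]) -` A \<inter> space M \<in> sets M"
          if "A \<in> sets (count_space (Seq (Xset G)))" for A
          by (rule measurable_sets[OF *]) (use that in \<open>auto simp: Seq_def\<close>)
      qed (use in_Seq in simp)
    qed
    moreover have "countable (Seq (Xset G))" using X by (auto simp: Seq_def)
    ultimately have "(\<lambda>z. map (\<lambda>k. \<alpha> (z k)) [2..<Suc n]) \<in> M \<rightarrow>\<^sub>M borel_alg (discrete_topology (Seq (Xset G)))"
      by (intro measurable_discrete_borel_alg)
    moreover have "second_countable (discrete_topology (Seq (Xset G)))"
      using \<open>countable (Seq (Xset G))\<close> by (simp add: second_countable_discrete_topology)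
    ultimately show ?thesis
      using measurable_sets[OF measurable_pair_borel_alg[OF _ curz _ sc] tri]
      unfolding eq by (simp add: pred_def vimage_def Int_def conj_commute)
  qed
  have [measurable]: "Measurable.pred M (\<lambda>z. legal_at z n)" for n
  proof (cases "2 \<le> n")
    case True
    have "legal_at z n \<longleftrightarrow> (\<rho> (z n), cur (map z [0..<n])) \<in> le G \<and>
        (map \<alpha> (drop 2 (map z [0..<Suc n])), cur (map z [0..<n])) \<in> tri G" for z
      using True by (simp add: legal_at_def legal_def)
    then show ?thesis using pred_intros_logic(3)[OF le_pred tri_pred[OF True]] by simp
  next
    case False
    have "legal_at z n \<longleftrightarrow> n = 0 \<or> (\<rho> (z n), cur (map z [0..<n])) \<in> le G" for z
      using False by (simp add: legal_at_def legal_def)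
    then show ?thesis using le_pred[of n] by (cases "n = 0") simp_all
  qed
  note closure = \<Gamma>[unfolded suitable_def, THEN conjunct1, THEN spec, THEN mp, OF polish_real_omega]
  have real: "B \<in> \<Gamma> real_omega" if "B \<in> sets M" for B
    using closure[THEN conjunct2, THEN conjunct1] that unfolding M_def by (rule subsetD)
  have b1: "{z. \<exists>n. odd n \<and> \<not> legal_at z n \<and> (\<forall>m<n. legal_at z m)} \<in> \<Gamma> real_omega"
  proof (rule real)
    have "{z \<in> space M. \<exists>n. odd n \<and> \<not> legal_at z n \<and> (\<forall>m<n. legal_at z m)} \<in> sets M" by measurable
    then show "{z. \<exists>n. odd n \<and> \<not> legal_at z n \<and> (\<forall>m<n. legal_at z m)} \<in> sets M" by (simp add: spM)
  qed
  have b2: "{z. \<forall>n. legal_at z n} \<in> \<Gamma> real_omega"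
  proof (rule real)
    have "{z \<in> space M. \<forall>n. legal_at z n} \<in> sets M" by measurable
    then show "{z. \<forall>n. legal_at z n} \<in> sets M" by (simp add: spM)
  qed
  let ?out = "\<lambda>(z :: nat \<Rightarrow> real) n. \<alpha> (z (n + 2))"
  obtain U h where YX: "Y \<subseteq> topspace (X_omega G)" and U: "polish_topology U"
    and h: "homeomorphic_map (X_omega G) U h" and hY: "h ` Y \<in> \<Gamma> U"
    using Y unfolding class_subset_def by (elim exE conjE)
  have "?out \<in> M \<rightarrow>\<^sub>M borel_alg (X_omega G)"
    by (rule measurable_into_discrete_omega[OF X, where F = "\<lambda>k z. \<alpha> (z (k + 2))"]) (rule \<alpha>z)
  then have "(\<lambda>z. h (?out z)) \<in> borel_alg real_omega \<rightarrow>\<^sub>M borel_alg U"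
    unfolding M_def
    by (rule measurable_compose[OF _ continuous_map_borel_alg[OF homeomorphic_imp_continuous_map[OF h]]])
  from suitable_vimage[OF \<Gamma> polish_real_omega U this hY]
  have "(\<lambda>z. h (?out z)) -` h ` Y \<in> \<Gamma> real_omega" by simp
  moreover have "(\<lambda>z. h (?out z)) -` h ` Y = ?out -` Y"
  proof -
    have "?out z \<in> topspace (X_omega G)" for z by (auto simp: \<alpha>_in)
    then show ?thesis
      using inj_on_image_mem_iff[OF homeomorphic_imp_injective_map[OF h] _ YX]
      by (simp add: vimage_def)
  qed
  ultimately have b3: "?out -` Y \<in> \<Gamma> real_omega" by simp
  have "A \<union> B \<in> \<Gamma> real_omega" "A \<inter> B \<in> \<Gamma> real_omega"
    if "A \<in> \<Gamma> real_omega" "B \<in> \<Gamma> real_omega" for A B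
    using closure[THEN conjunct2, THEN conjunct2, rule_format, OF that] by simp_all
  then have "payoff Y \<in> \<Gamma> real_omega"
    unfolding payoff_def using b1 b2 b3 by simp
  then show ?thesis
    using class_subset_univ_iff[OF \<Gamma> polish_real_omega] by blast
qed

theorem corollary2p8:
  fixes \<Gamma> :: "univ topology \<Rightarrow> univ set set"
  assumes "suitable \<Gamma>"
    and "\<And>A. class_subset \<Gamma> real_omega A \<Longrightarrow> determined A"
  shows "\<forall>G :: ('p, 'x) gowers. analytic_gowers_space G \<longrightarrow>
    (\<forall>\<X>. class_subset \<Gamma> (X_omega G) \<X> \<longrightarrow> adversarially_Ramsey G \<X>)"
proof (intro allI impI)
  fix G :: "('p, 'x) gowers" and \<X>
  assume "analytic_gowers_space G" and X: "class_subset \<Gamma> (X_omega G) \<X>"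
  then obtain T where G: "gowers_space G" and T: "polish_topology T" "Pset G \<subseteq> topspace T"
    and an: "analytic_in T (Pset G)"
    and le: "le G \<in> sets (borel_alg (prod_topology (subtopology T (Pset G)) (subtopology T (Pset G))))"
    and tri: "tri G \<in> sets (borel_alg (prod_topology (discrete_topology (Seq (Xset G))) (subtopology T (Pset G))))"
    unfolding analytic_gowers_space_def by (elim exE conjE)
  obtain \<alpha> :: "real \<Rightarrow> 'x" and \<rho> :: "real \<Rightarrow> 'p" where decode: "range (\<lambda>r. (\<alpha> r, \<rho> r)) = Xset G \<times> Pset G"
    and meas: "\<alpha> \<in> borel \<rightarrow>\<^sub>M count_space (Xset G)" "\<rho> \<in> borel \<rightarrow>\<^sub>M borel_alg (subtopology T (Pset G))"
    by (rule analytic_gowers_space_coding[OF G an T(2)])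
  show "adversarially_Ramsey G \<X>"
    unfolding adversarially_Ramsey_def
  proof
    fix p assume p: "p \<in> Pset G"
    interpret kastanas_game G p \<alpha> \<rho>
      using G p decode by unfold_locales
    have "determined (payoff \<X>)"
      by (rule assms(2), rule payoff_in_class[OF assms(1) kastanas_game_axioms T le tri meas X])
    then consider \<sigma> where "\<And>z. follows True \<sigma> z \<Longrightarrow> z \<in> payoff \<X>"
      | \<tau> where "\<And>z. follows False \<tau> z \<Longrightarrow> z \<notin> payoff \<X>"
      unfolding determined_def follows_def by auto
    then show "\<exists>q\<in>Pset G. (q, p) \<in> le G \<and>
        (I_reaches_in_A G q \<X> \<or> II_reaches_in_B G q (topspace (X_omega G) - \<X>))"
    proof cases
      case 1
      show ?thesis using I_wins_imp_reaches_in_A[OF winning_first[OF 1]] by blast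
    next
      case 2
      show ?thesis using II_wins_imp_reaches_in_B[OF winning_second[OF 2]] by blast
    qed
  qed
qed

end
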